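(* Let $q$ be an odd prime such that $p=\frac{q^q-1}{q-1}$ is a prime. Then the intersection density of any imprimitive (transitive) permutation representation of $\operatorname{PSL}_q(q)$ of degree $pq$ is equal to $1$.
   Context: All groups are finite. A transitive permutation group $G\leq\operatorname{Sym}(\Omega)$ is imprimitive if there is $S\subseteq\Omega$ with $1<|S|<|\Omega|$ such that for every $g\in G$ either $S^g=S$ or $S^g\cap S=\varnothing$. A subset $\mathcal{F}\subseteq G$ is intersecting if for all $g,h\in\mathcal{F}$ there exists $\omega\in\Omega$ with $\omega^g=\omega^h$. The intersection density of a transitive group $G\leq \operatorname{Sym}(\Omega)$ is $\rho(G)=\max\{|\mathcal{F}|/|G_\omega| : \mathcal{F}\subseteq G \text{ intersecting}\}$, where $G_\omega$ is the stabilizer of a point $\omega\in\Omega$. The degree of a permutation representation on $\Omega$ is $|\Omega|$. *)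

theory Defs
  imports
    "HOL-Algebra.Group_Action"
    "HOL-Computational_Algebra.Primes"
    "Jordan_Normal_Form.Determinant"
begin

section \<open>The groups SL and PSL over a field\<close>

definition SL :: "nat \<Rightarrow> 'k::field mat monoid" where
  "SL n = \<lparr>carrier = {A \<in> carrier_mat n n. Determinant.det A = 1}, monoid.mult = (*), one = 1\<^sub>m n\<rparr>"

definition scalars_SL :: "nat \<Rightarrow> 'k::field mat set" where
  "scalars_SL n = {A \<in> carrier (SL n). \<exists>c. A = c \<cdot>\<^sub>m 1\<^sub>m n}"

definition PSL :: "nat \<Rightarrow> 'k::field mat set monoid" where
  "PSL n = SL n Mod scalars_SL n"

lemma group_SL: "group (SL n :: 'k::field mat monoid)"
proof (rule groupI)
  fix A :: "'k mat" assume "A \<in> carrier (SL n)"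
  then have A: "A \<in> carrier_mat n n" "Determinant.det A = 1"
    by (auto simp: SL_def)
  have "Determinant.det (adj_mat A) * Determinant.det A = Determinant.det (adj_mat A * A)"
    using A adj_mat(1)[OF A(1)] by (simp add: det_mult)
  also have "\<dots> = 1"
    using adj_mat(3)[OF A(1)] A by (simp add: det_smult)
  finally have "Determinant.det (adj_mat A) = 1" using A by simp
  moreover have "adj_mat A * A = 1\<^sub>m n"
    using adj_mat(3)[OF A(1)] A(2) by auto
  ultimately show "\<exists>y\<in>carrier (SL n). y \<otimes>\<^bsub>SL n\<^esub> A = \<one>\<^bsub>SL n\<^esub>"
    using adj_mat(1)[OF A(1)] by (auto simp: SL_def)
qed (auto simp: SL_def det_mult)

lemma normal_scalars_SL: "scalars_SL n \<lhd> (SL n :: 'k::field mat monoid)"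
proof -
  interpret group "SL n :: 'k mat monoid" by (rule group_SL)
  have comm: "A \<otimes>\<^bsub>SL n\<^esub> B = B \<otimes>\<^bsub>SL n\<^esub> A"
    if "A \<in> scalars_SL n" "B \<in> carrier (SL n)" for A B :: "'k mat"
  proof -
    from that obtain c where "A = c \<cdot>\<^sub>m 1\<^sub>m n" "B \<in> carrier_mat n n"
      by (auto simp: scalars_SL_def SL_def)
    then show ?thesis
      by (simp add: SL_def mult_smult_assoc_mat[of _ n n _ n] mult_smult_distrib[of _ n n _ n])
  qed
  have sub: "scalars_SL n \<subseteq> carrier (SL n :: 'k mat monoid)"
    by (auto simp: scalars_SL_def)
  have one: "\<one>\<^bsub>SL n\<^esub> \<in> (scalars_SL n :: 'k mat set)"
    unfolding scalars_SL_def by (auto simp: SL_def intro!: exI[of _ 1])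
  have mult: "A \<otimes>\<^bsub>SL n\<^esub> B \<in> scalars_SL n"
    if "A \<in> scalars_SL n" "B \<in> scalars_SL n" for A B :: "'k mat"
  proof -
    from that obtain c d where "A = c \<cdot>\<^sub>m 1\<^sub>m n" "B = d \<cdot>\<^sub>m 1\<^sub>m n"
      by (auto simp: scalars_SL_def)
    then have "A * B = (c * d) \<cdot>\<^sub>m 1\<^sub>m n"
      by (auto simp: mult_smult_assoc_mat[of _ n n _ n] mult_smult_distrib[of _ n n _ n])
    moreover have "A \<otimes>\<^bsub>SL n\<^esub> B \<in> carrier (SL n)"
      using that sub by auto
    ultimately show ?thesis
      by (auto simp: scalars_SL_def SL_def)
  qed
  have inv: "inv\<^bsub>SL n\<^esub> A \<in> scalars_SL n" if A: "A \<in> scalars_SL n" for A :: "'k mat"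
  proof -
    from A obtain c where c: "A = c \<cdot>\<^sub>m 1\<^sub>m n" by (auto simp: scalars_SL_def)
    have "Determinant.det A = 1" using A by (simp add: scalars_SL_def SL_def)
    then have cn: "c ^ n = 1" using c by simp
    let ?B = "inverse c \<cdot>\<^sub>m 1\<^sub>m n :: 'k mat"
    have "Determinant.det ?B = 1" using cn by (simp add: power_inverse)
    then have B: "?B \<in> carrier (SL n)" by (simp add: SL_def)
    have "?B * A = 1\<^sub>m n"
    proof (cases "n = 0")
      case True then show ?thesis using c by auto
    next
      case False
      with cn have "c \<noteq> 0" by (auto simp: power_0_left)
      then show ?thesis using c
        by (auto simp: mult_smult_assoc_mat[of _ n n _ n] mult_smult_distrib[of _ n n _ n])
    qed
    then have "inv\<^bsub>SL n\<^esub> A = ?B"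
      using A B sub by (intro inv_equality) (auto simp: SL_def)
    then show ?thesis using B by (auto simp: scalars_SL_def)
  qed
  have "subgroup (scalars_SL n) (SL n :: 'k mat monoid)"
    using sub one mult inv by (intro subgroup.intro) auto
  then show ?thesis
  proof (rule normal_invI)
    fix B A :: "'k mat" assume *: "B \<in> carrier (SL n)" "A \<in> scalars_SL n"
    then have "B \<otimes>\<^bsub>SL n\<^esub> A \<otimes>\<^bsub>SL n\<^esub> inv\<^bsub>SL n\<^esub> B = A"
      using sub comm[OF *(2,1)] by (metis inv_solve_right' m_closed subsetD)
    with * show "B \<otimes>\<^bsub>SL n\<^esub> A \<otimes>\<^bsub>SL n\<^esub> inv\<^bsub>SL n\<^esub> B \<in> scalars_SL n" by simp
  qed
qed

lemma group_PSL: "group (PSL n :: 'k::field mat set monoid)"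
  unfolding PSL_def using normal_scalars_SL by (rule normal.factorgroup_is_group)

section \<open>Permutation groups and intersection density\<close>

text \<open>
  A permutation group on \<open>\<Omega>\<close> is given as a subgroup \<open>P\<close> of \<^term>\<open>BijGroup \<Omega>\<close>, i.e. by its set of
  elements.
\<close>

definition transitive_perm_group :: "'a set \<Rightarrow> ('a \<Rightarrow> 'a) set \<Rightarrow> bool" where
  "transitive_perm_group \<Omega> P \<longleftrightarrow>
     subgroup P (BijGroup \<Omega>) \<and> (\<forall>x\<in>\<Omega>. \<forall>y\<in>\<Omega>. \<exists>g\<in>P. g x = y)"

definition imprimitive_perm_group :: "'a set \<Rightarrow> ('a \<Rightarrow> 'a) set \<Rightarrow> bool" where
  "imprimitive_perm_group \<Omega> P \<longleftrightarrow>
     transitive_perm_group \<Omega> P \<and>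
     (\<exists>S\<subseteq>\<Omega>. 1 < card S \<and> card S < card \<Omega> \<and> (\<forall>g\<in>P. g ` S = S \<or> g ` S \<inter> S = {}))"

definition intersecting :: "'a set \<Rightarrow> ('a \<Rightarrow> 'a) set \<Rightarrow> bool" where
  "intersecting \<Omega> F \<longleftrightarrow> (\<forall>g\<in>F. \<forall>h\<in>F. \<exists>\<omega>\<in>\<Omega>. g \<omega> = h \<omega>)"

definition point_stabilizer :: "('a \<Rightarrow> 'a) set \<Rightarrow> 'a \<Rightarrow> ('a \<Rightarrow> 'a) set" where
  "point_stabilizer P \<omega> = {g \<in> P. g \<omega> = \<omega>}"

text \<open>
  The base point is an explicit argument; for transitive \<open>P\<close> all point stabilizers are conjugate,
  so the value does not depend on it. The maximum is meaningful for finite \<open>P\<close>.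
\<close>

definition intersection_density :: "'a set \<Rightarrow> ('a \<Rightarrow> 'a) set \<Rightarrow> 'a \<Rightarrow> real" where
  "intersection_density \<Omega> P \<omega> =
     Max {real (card F) / real (card (point_stabilizer P \<omega>)) | F. F \<subseteq> P \<and> intersecting \<Omega> F}"

end

theory Submission
  imports
    Defs
    "HOL-Algebra.Sylow"
    "HOL-Algebra.Multiplicative_Group"
    "HOL-Number_Theory.Residues"
begin

text \<open>
  The theorem follows from the clique-coclique bound
  (\<open>intersection_density_eq_1_if_clique\<close>): it suffices to find \<open>p * q\<close> elements of the group such
  that no two of them agree at a point. They form a group of order \<open>p * q\<close>, generated by the matrices
  \<open>c\<close> (\<open>artin_schreier\<close>) and \<open>f\<close> (\<open>pascal\<close>) in \<open>SL\<^sub>q(q)\<close> that describe multiplication by \<open>X\<close> and the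
  substitution \<open>X \<mapsto> X + 1\<close> on \<open>k[X] / (X\<^sup>q - X - 1)\<close>, where \<open>k\<close> has \<open>q\<close> elements. Since
  \<open>X\<^sup>q = X + 1\<close>, one has \<open>f c f\<^sup>-\<^sup>1 = c\<^sup>q\<close>, \<open>c\<^sup>p = 1\<close> and \<open>f\<^sup>q = 1\<close>. Every
  element outside \<open>\<langle>c\<rangle>\<close> is conjugate to a power of \<open>f\<close>; so it remains to show that \<open>c\<close> and \<open>f\<close> fix no
  point (\<open>frobenius_group_semiregular\<close>).

  A block system has \<open>p\<close> or \<open>q\<close> blocks. Two facts about actions on few points are used throughout.
  On \<open>q\<close> points, a transvection that is a central commutator of two others acts trivially, because
  the \<open>q\<close>-subgroups of the symmetric group of degree \<open>q\<close> are abelian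
  (\<open>elementary_act_trivially\<close>). And a block triangular group whose elementary transvections all act
  trivially acts through diagonal matrices, hence with exponent dividing \<open>q - 1\<close>, and cannot be
  transitive on a set whose cardinality is a prime not dividing \<open>q - 1\<close>
  (\<open>transvections_act_nontrivially\<close>). Together they exclude \<open>q\<close> blocks.

  So there are \<open>p\<close> blocks of size \<open>q\<close>. For a block \<open>D\<close> with stabilizer \<open>K\<close> let \<open>W\<close> be the set of those
  \<open>v\<close> for which \<open>K\<close> contains all transvections with center \<open>v\<close>. This is a \<open>K\<close>-invariant subspace.
  For some \<open>D\<close> it contains the first unit vector \<open>e\<close>, because the elations with center \<open>e\<close> form a
  \<open>q\<close>-group acting on \<open>p\<close> blocks, and \<open>q\<close> does not divide \<open>p\<close>; so \<open>W\<close> is never zero, and it is never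
  the full space by the second fact. The vectors \<open>c\<^sup>i e\<close> are the unit vectors, so \<open>c\<close> does not
  fix this \<open>D\<close>; as its order is \<open>p\<close>, it permutes all blocks in one cycle and fixes no point.

  Suppose that \<open>f\<close> fixes a point of \<open>D\<close>. Then \<open>W\<close> is invariant under the single Jordan block \<open>f\<close> and
  thus spanned by the first \<open>d\<close> unit vectors, \<open>0 < d < q\<close>; as \<open>K\<close> has prime index, it is the
  stabilizer of \<open>W\<close>, a maximal parabolic subgroup, and it acts transitively on the \<open>q\<close> points of \<open>D\<close>.
  By the first fact, an elementary transvection in \<open>K\<close> acts trivially on \<open>D\<close> unless it lies in a diagonal
  block of size two. Since \<open>q\<close> is odd, there is at most one such block. Modulo the other
  transvections, \<open>f\<close> equals a nontrivial elementary transvection in that block; having a fixed point,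
  it acts trivially as well, and so do all elementary transvections of the block. This contradicts the
  second fact.
\<close>

section \<open>Actions of finite groups\<close>

lemma (in group) card_subgroup_dvd:
  assumes "subgroup R G" "subgroup K G" "R \<subseteq> K"
  shows "card R dvd card K"
proof -
  have "subgroup R (G\<lparr>carrier := K\<rparr>)" using assms by (simp add: subgroup_incl)
  then have "card R dvd Coset.order (G\<lparr>carrier := K\<rparr>)"
    using group.lagrange[OF subgroup_imp_group[OF assms(2)]] by (metis dvd_triv_right)
  then show ?thesis by (simp add: Coset.order_def)
qed

text \<open>
  An action of \<open>G\<close> on \<open>X\<close>, given by a function of two arguments that matters only on
  \<^term>\<open>carrier G\<close> and \<open>X\<close>. In contrast to \<^const>\<open>group_action\<close>, the maps need not be
  undefined outside \<open>X\<close>; so one function can serve for a group, its subgroups and all invariant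
  subsets.
\<close>

locale set_action = group G for G (structure) +
  fixes X :: "'x set" and act :: "'a \<Rightarrow> 'x \<Rightarrow> 'x"
  assumes act_closed: "\<lbrakk>g \<in> carrier G; x \<in> X\<rbrakk> \<Longrightarrow> act g x \<in> X"
    and act_one: "x \<in> X \<Longrightarrow> act \<one> x = x"
    and act_mult: "\<lbrakk>g \<in> carrier G; h \<in> carrier G; x \<in> X\<rbrakk> \<Longrightarrow> act (g \<otimes> h) x = act g (act h x)"
begin

lemma act_inv:
  assumes "g \<in> carrier G" "x \<in> X"
  shows "act (inv g) (act g x) = x" "act g (act (inv g) x) = x"
  using act_mult[of "inv g" g x] act_mult[of g "inv g" x] assms act_one by auto

lemma act_inj:
  assumes "g \<in> carrier G" "x \<in> X" "y \<in> X" "act g x = act g y"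
  shows "x = y"
  using act_inv(1)[OF assms(1,2)] act_inv(1)[OF assms(1,3)] assms(4) by metis

lemma act_bij: "g \<in> carrier G \<Longrightarrow> bij_betw (act g) X X"
  by (rule bij_betw_byWitness[where f' = "act (inv g)"])
    (use act_inv act_closed inv_closed in blast)+

lemma act_pow:
  assumes "g \<in> carrier G" "x \<in> X"
  shows "act (g [^] (k::nat)) x = (act g ^^ k) x"
  using assms
proof (induction k)
  case 0 then show ?case by (simp add: act_one)
next
  case (Suc k)
  then have "act (g [^] Suc k) x = act (g \<otimes> g [^] k) x"
    using nat_pow_Suc2[of g k] by simp
  then show ?case using Suc by (simp add: act_mult)
qed

lemma act_pow_closed:
  assumes "g \<in> carrier G" "x \<in> X"
  shows "act (g [^] (k::nat)) x \<in> X"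
  using assms by (simp add: act_closed)

lemma act_pow_fixed:
  assumes "g \<in> carrier G" "x \<in> X" "act g x = x"
  shows "act (g [^] (k::nat)) x = x"
  unfolding act_pow[OF assms(1,2)] using assms(3) by (induction k) auto

lemma fixed_if_coprime_pow_fixed:
  assumes "g \<in> carrier G" "x \<in> X" "act (g [^] (m::nat)) x = x" "act (g [^] (n::nat)) x = x"
    and "coprime m n"
  shows "act g x = x"
proof (cases "m = 0")
  case True
  with assms show ?thesis by simp
next
  case False
  then obtain a b where ab: "m * a = n * b + 1"
    using bezout_nat[of m n] assms(5) by auto
  have "act (g [^] (m * a)) x = x"
    using act_pow_fixed[of "g [^] m" x a] assms by (simp add: nat_pow_pow)
  moreover have "act (g [^] (n * b)) x = x"
    using act_pow_fixed[of "g [^] n" x b] assms by (simp add: nat_pow_pow)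
  moreover have "g [^] (n * b + 1) = g \<otimes> g [^] (n * b)"
    using assms(1) nat_pow_Suc2[of g "n * b"] by simp
  then have "act (g [^] (m * a)) x = act g (act (g [^] (n * b)) x)"
    unfolding ab using assms(1,2) by (simp only: act_mult nat_pow_closed)
  ultimately show ?thesis by simp
qed

lemma orbit_of_prime_order:
  assumes "g \<in> carrier G" "card X = r" "prime r"
    and "x0 \<in> X" "act (g [^] r) x0 = x0" "act g x0 \<noteq> x0"
  shows "X = (\<lambda>i::nat. act (g [^] i) x0) ` {..<r}"
proof -
  have fin: "finite X" using assms(2,3) by (metis card.infinite not_prime_0)
  have *: "i = j" if "i \<le> j" "j < r" "act (g [^] i) x0 = act (g [^] j) x0" for i j :: nat
  proof (rule ccontr)
    assume "i \<noteq> j"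
    with that have lt: "0 < j - i" "j - i < r" by auto
    have "g [^] j = g [^] i \<otimes> g [^] (j - i)"
      using assms(1) that by (simp add: nat_pow_mult)
    then have "act (g [^] i) (act (g [^] (j - i)) x0) = act (g [^] i) x0"
      using that assms by (simp add: act_mult)
    then have "act (g [^] (j - i)) x0 = x0"
      by (rule act_inj[rotated 3]) (use assms(1,4) in \<open>auto intro: act_closed\<close>)
    moreover have "coprime (j - i) r"
      using lt assms(3) by (metis coprime_commute nat_dvd_not_less prime_imp_coprime)
    ultimately show False
      using fixed_if_coprime_pow_fixed[OF assms(1,4) _ assms(5)] assms(6) by blast
  qed
  then have "inj_on (\<lambda>i::nat. act (g [^] i) x0) {..<r}"
    by (intro inj_onI) (metis lessThan_iff linorder_le_cases)
  then have "card ((\<lambda>i::nat. act (g [^] i) x0) ` {..<r}) = card X"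
    using assms(2) by (simp add: card_image)
  then show ?thesis
    using fin assms by (intro card_subset_eq[symmetric]) (auto intro: act_pow_closed)
qed

text \<open>
  On \<open>r\<close> points, \<open>r\<close> prime, a permutation of order dividing \<open>r\<close> is an \<open>r\<close>-cycle or the identity.
\<close>

lemma trivial_if_fixed_point:
  assumes "g \<in> carrier G" "card X = r" "prime r"
    and pow: "\<And>x. x \<in> X \<Longrightarrow> act (g [^] r) x = x"
    and "x0 \<in> X" "act g x0 = x0" and "x \<in> X"
  shows "act g x = x"
proof (rule ccontr)
  assume "act g x \<noteq> x"
  then have "X = (\<lambda>i::nat. act (g [^] i) x) ` {..<r}"
    using orbit_of_prime_order[of g r x] assms by blast
  with assms obtain i :: nat where i: "x0 = act (g [^] i) x" by auto
  have "act (g [^] i) (act g x) = act g (act (g [^] i) x)"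
    using assms(1,7) nat_pow_Suc2[of g i]
    by (simp add: act_mult[symmetric])
  also have "\<dots> = act (g [^] i) x" using assms(6) i by simp
  finally show False
    using act_inj[of "g [^] i" "act g x" x] assms \<open>act g x \<noteq> x\<close> act_closed by simp
qed

text \<open>
  Two permutations of order dividing a prime \<open>r\<close> of a set with \<open>r\<close> points whose commutator
  is central and of order dividing \<open>r\<close> must commute: the centralizer of an \<open>r\<close>-cycle in the
  symmetric group of degree \<open>r\<close> is generated by that cycle.
\<close>

lemma central_commutator_trivial:
  assumes G: "x \<in> carrier G" "y \<in> carrier G" "z \<in> carrier G"
    and comm: "x \<otimes> y = z \<otimes> (y \<otimes> x)" and zx: "z \<otimes> x = x \<otimes> z" and zy: "z \<otimes> y = y \<otimes> z"
    and X: "card X = r" "prime r" and pow: "\<And>u. u \<in> X \<Longrightarrow> act (z [^] r) u = u"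
    and "u \<in> X"
  shows "act z u = u"
proof (rule ccontr)
  assume ne: "act z u \<noteq> u"
  then have all: "X = (\<lambda>i::nat. act (z [^] i) u) ` {..<r}"
    using orbit_of_prime_order[of z r u] assms by blast
  have powr: "\<exists>a::nat. \<forall>v\<in>X. act w v = act (z [^] a) v"
    if w: "w \<in> carrier G" and c: "z \<otimes> w = w \<otimes> z" for w
  proof -
    have "act w u \<in> X" using w \<open>u \<in> X\<close> by (rule act_closed)
    then obtain a :: nat where a: "act w u = act (z [^] a) u" using all by auto
    have "act w v = act (z [^] a) v" if "v \<in> X" for v
    proof -
      obtain i :: nat where i: "v = act (z [^] i) u" using \<open>v \<in> X\<close> all by auto
      have zi: "z [^] i \<otimes> w = w \<otimes> z [^] i"
        using group_commutes_pow[OF c] w G by simp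
      have "act w v = act (w \<otimes> z [^] i) u" using i w G \<open>u \<in> X\<close> by (simp add: act_mult)
      also have "\<dots> = act (z [^] i) (act (z [^] a) u)"
        using w G \<open>u \<in> X\<close> a by (simp add: zi[symmetric] act_mult)
      also have "\<dots> = act (z [^] a) v"
        using i G \<open>u \<in> X\<close> by (simp add: act_mult[symmetric] nat_pow_mult add.commute)
      finally show ?thesis .
    qed
    then show ?thesis by blast
  qed
  obtain a b :: nat where a: "\<forall>v\<in>X. act x v = act (z [^] a) v"
    and b: "\<forall>v\<in>X. act y v = act (z [^] b) v"
    using powr[OF G(1) zx] powr[OF G(2) zy] by auto
  have "act (x \<otimes> y) u = act (z [^] a) (act (z [^] b) u)"
    using a b G \<open>u \<in> X\<close> act_closed by (simp add: act_mult)
  also have "\<dots> = act (z [^] b) (act (z [^] a) u)"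
    using G(3) \<open>u \<in> X\<close> by (simp add: act_mult[symmetric] nat_pow_mult add.commute)
  also have "\<dots> = act (y \<otimes> x) u"
    using a b G \<open>u \<in> X\<close> act_closed by (simp add: act_mult)
  finally have "act (x \<otimes> y) u = act (y \<otimes> x) u" .
  then have "act z (act (y \<otimes> x) u) = act (y \<otimes> x) u"
    using comm G \<open>u \<in> X\<close> act_mult[of z "y \<otimes> x" u] by simp
  then have "act z u = u"
    using trivial_if_fixed_point[OF G(3) X pow _ _ \<open>u \<in> X\<close>, of "act (y \<otimes> x) u"]
      act_closed[of "y \<otimes> x" u] G \<open>u \<in> X\<close> by simp
  with ne show False ..
qed

text \<open>
  The stabilizer of a point.
\<close>

definition stab :: "'x \<Rightarrow> 'a set" where
  "stab x = {g \<in> carrier G. act g x = x}"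

lemma group_action_restrict: "group_action G X (\<lambda>g. restrict (act g) X)"
proof -
  have bij: "restrict (act g) X \<in> carrier (BijGroup X)" if "g \<in> carrier G" for g
    using act_bij[OF that] by (auto simp: BijGroup_def Bij_def cong: bij_betw_cong)
  have "(\<lambda>g. restrict (act g) X) \<in> hom G (BijGroup X)"
  proof (rule homI)
    fix g h assume *: "g \<in> carrier G" "h \<in> carrier G"
    then show "restrict (act (g \<otimes> h)) X =
        restrict (act g) X \<otimes>\<^bsub>BijGroup X\<^esub> restrict (act h) X"
      using bij[OF *(1)] bij[OF *(2)]
      by (auto simp: BijGroup_def compose_def act_mult act_closed fun_eq_iff)
  qed (rule bij)
  then show ?thesis
    by (intro group_action.intro group_hom.intro group_hom_axioms.intro group_BijGroup is_group)
qed

lemma stabilizer_restrict: "x \<in> X \<Longrightarrow> stabilizer G (\<lambda>g. restrict (act g) X) x = stab x"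
  by (auto simp: stabilizer_def stab_def)

lemma orbit_restrict: "x \<in> X \<Longrightarrow> orbit G (\<lambda>g. restrict (act g) X) x = (\<lambda>g. act g x) ` carrier G"
  by (auto simp: orbit_def)

lemma subgroup_stab: "x \<in> X \<Longrightarrow> subgroup (stab x) G"
  using group_action.stabilizer_subgroup[OF group_action_restrict] stabilizer_restrict by metis

lemma orbit_stab:
  assumes "x \<in> X"
  shows "card ((\<lambda>g. act g x) ` carrier G) * card (stab x) = Coset.order G"
  using group_action.orbit_stabilizer_theorem[OF group_action_restrict assms]
  by (simp add: orbit_restrict stabilizer_restrict assms)

lemma set_action_subgroup:
  assumes "subgroup K G" "Y \<subseteq> X" "\<And>g x. \<lbrakk>g \<in> K; x \<in> Y\<rbrakk> \<Longrightarrow> act g x \<in> Y"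
  shows "set_action (G\<lparr>carrier := K\<rparr>) Y act"
proof -
  interpret K: group "G\<lparr>carrier := K\<rparr>" using assms(1) by (simp add: subgroup_imp_group)
  have "K \<subseteq> carrier G" using assms(1) by (rule subgroup.subset)
  then show ?thesis
    using assms(2,3) act_one act_mult by unfold_locales (auto simp: subset_iff)
qed

text \<open>
  If a finite group acts transitively on a set of prime cardinality \<open>r\<close>, then its Sylow
  \<open>r\<close>-subgroups do not fit into a point stabilizer; so they move a point, and the exponent of the
  permutation group is divisible by \<open>r\<close>.
\<close>

lemma prime_degree_exponent:
  assumes fin: "finite (carrier G)" and X: "card X = r" "prime r"
    and trans: "\<And>x y. \<lbrakk>x \<in> X; y \<in> X\<rbrakk> \<Longrightarrow> \<exists>g\<in>carrier G. act g x = y"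
    and m: "\<not> r dvd m" and pow: "\<And>g x. \<lbrakk>g \<in> carrier G; x \<in> X\<rbrakk> \<Longrightarrow> act (g [^] m) x = x"
  shows False
proof -
  obtain x where x: "x \<in> X" using X by (metis card.empty equals0I not_prime_0)
  have "(\<lambda>g. act g x) ` carrier G = X" using trans x act_closed by blast
  then have ord: "r * card (stab x) = Coset.order G" using orbit_stab[OF x] X by simp
  have "Coset.order G > 0" using fin order_gt_0_iff_finite by blast
  then have st: "card (stab x) \<noteq> 0" unfolding ord[symmetric] by simp
  define a where "a = multiplicity r (card (stab x))"
  obtain s where s: "card (stab x) = r ^ a * s" "\<not> r dvd s"
    using multiplicity_decompose'[of "card (stab x)" r] st X(2) unfolding a_def
    by (metis not_prime_unit)
  have "Coset.order G = r ^ Suc a * s" using ord s by simp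
  then obtain R where R: "subgroup R G" "card R = r ^ Suc a"
    using sylow_thm[OF X(2) is_group _ fin] by blast
  have "\<not> R \<subseteq> stab x"
  proof
    assume "R \<subseteq> stab x"
    then have "card R dvd card (stab x)"
      using card_subgroup_dvd[OF R(1) subgroup_stab[OF x]] by blast
    then have "r ^ a * r dvd r ^ a * s" unfolding R(2) s(1) by (simp only: power_Suc2)
    then show False using s(2) X(2) by (simp add: prime_gt_0_nat)
  qed
  then obtain g where g: "g \<in> R" "g \<notin> stab x" by blast
  have gG: "g \<in> carrier G" using R(1) g subgroup.subset by blast
  have "g [^]\<^bsub>G\<lparr>carrier := R\<rparr>\<^esub> Coset.order (G\<lparr>carrier := R\<rparr>) = \<one>\<^bsub>G\<lparr>carrier := R\<rparr>\<^esub>"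
    using group.pow_order_eq_1[OF subgroup_imp_group[OF R(1)]] g by simp
  then have "g [^] (r ^ Suc a) = \<one>"
    using R(2) by (simp add: Coset.order_def nat_pow_consistent[symmetric])
  then have "act (g [^] (r ^ Suc a)) x = x" using act_one x by simp
  moreover have "act (g [^] m) x = x" using pow gG x by blast
  moreover have "coprime (r ^ Suc a) m"
    using m X(2) by (simp add: prime_imp_coprime)
  ultimately have "act g x = x" using fixed_if_coprime_pow_fixed gG x by blast
  with g gG show False by (simp add: stab_def)
qed

text \<open>
  Orbits of an \<open>r\<close>-group have \<open>r\<close>-power length; so it fixes a point of any set whose cardinality
  is not divisible by \<open>r\<close>.
\<close>

lemma prime_power_fixed_point:
  assumes ord: "Coset.order G = r ^ a" and "prime r" and fin: "finite X" and X: "\<not> r dvd card X"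
  shows "\<exists>x\<in>X. \<forall>g\<in>carrier G. act g x = x"
proof (rule ccontr)
  assume none: "\<not> ?thesis"
  interpret ga: group_action G X "\<lambda>g. restrict (act g) X" by (rule group_action_restrict)
  let ?O = "orbits G X (\<lambda>g. restrict (act g) X)"
  have "r dvd card C" if "C \<in> ?O" for C
  proof -
    obtain x where x: "x \<in> X" "C = (\<lambda>g. act g x) ` carrier G"
      using \<open>C \<in> ?O\<close> by (auto simp: orbits_def orbit_restrict)
    have "card C dvd r ^ a" using orbit_stab[OF x(1)] x(2) ord by (metis dvd_triv_left)
    then obtain b where b: "card C = r ^ b"
      using \<open>prime r\<close> divides_primepow_nat by blast
    have "b \<noteq> 0"
    proof
      assume "b = 0"
      then obtain y where y: "C = {y}" using b by (metis card_1_singletonE power_0)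
      then have "\<forall>g\<in>carrier G. act g x = y" using x by blast
      moreover have "x = y" using calculation act_one[OF x(1)] one_closed by force
      ultimately have "\<forall>g\<in>carrier G. act g x = x" by simp
      then show False using none x by blast
    qed
    then show ?thesis using b by (simp add: dvd_power)
  qed
  moreover have "card X = (\<Sum>C\<in>?O. card C)"
    using partition.disjoint_sum[OF ga.orbit_partition fin, of "\<lambda>_. 1 :: nat"] by simp
  ultimately have "r dvd card X" by (simp add: dvd_sum)
  with X show False ..
qed

end

lemma (in group) subgroup_acting_trivially:
  assumes K: "subgroup K G" and act: "set_action (G\<lparr>carrier := K\<rparr>) X act"
  shows "subgroup {g \<in> K. \<forall>x\<in>X. act g x = x} G" (is "subgroup ?S G")
proof (rule subgroupI)
  interpret K: set_action "G\<lparr>carrier := K\<rparr>" X act by (rule act)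
  show "?S \<subseteq> carrier G" using subgroup.subset[OF K] by blast
  have "\<one> \<in> ?S" using K.act_one subgroup.one_closed[OF K] by simp
  then show "?S \<noteq> {}" by blast
  fix a assume a: "a \<in> ?S"
  then have aK: "a \<in> K" "inv a \<in> K" using subgroup.m_inv_closed[OF K] by auto
  have "inv\<^bsub>G\<lparr>carrier := K\<rparr>\<^esub> a = inv a" using m_inv_consistent[OF K] aK by simp
  then show "inv a \<in> ?S" using a aK K.act_inv(1)[of a] by auto
  fix b assume "b \<in> ?S"
  then show "a \<otimes> b \<in> ?S"
    using a subgroup.m_closed[OF K, of a b] K.act_mult[of a b] by auto
qed

lemma (in group) pow_mod_eq:
  assumes "x \<in> carrier G" "x [^] (n::nat) = \<one>" "[a = b] (mod n)"
  shows "x [^] a = x [^] b"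
proof -
  have "x [^] a = x [^] (a mod n)" for a
  proof -
    have "x [^] a = x [^] (n * (a div n) + a mod n)" by simp
    also have "\<dots> = (x [^] n) [^] (a div n) \<otimes> x [^] (a mod n)"
      using assms(1) by (simp only: nat_pow_mult[symmetric] nat_pow_pow nat_pow_closed)
    finally show ?thesis using assms(1,2) by simp
  qed
  then show ?thesis using assms(3) unfolding cong_def by metis
qed

text \<open>
  Conjugation by \<open>f\<close> raises the elements of the cyclic group generated by \<open>c\<close> to the \<open>q\<close>-th power.
\<close>

lemma (in group) pow_normalizes:
  assumes "c \<in> carrier G" "f \<in> carrier G" "f \<otimes> c = c [^] (q::nat) \<otimes> f"
  shows "f [^] (m::nat) \<otimes> c [^] (a::nat) = c [^] (a * q ^ m) \<otimes> f [^] m"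
proof -
  have 1: "f \<otimes> c [^] (a::nat) = c [^] (a * q) \<otimes> f" for a
  proof (induction a)
    case (Suc a)
    have "f \<otimes> c [^] Suc a = (f \<otimes> c [^] a) \<otimes> c" using assms by (simp add: m_assoc)
    also have "\<dots> = c [^] (a * q) \<otimes> (f \<otimes> c)" using Suc assms by (simp add: m_assoc)
    also have "\<dots> = (c [^] (a * q) \<otimes> c [^] q) \<otimes> f"
      unfolding assms(3) using assms by (simp add: m_assoc)
    finally show ?case using assms by (simp add: nat_pow_mult add.commute)
  qed (use assms in simp)
  show ?thesis
  proof (induction m arbitrary: a)
    case (Suc m)
    have "f [^] Suc m \<otimes> c [^] a = f [^] m \<otimes> (f \<otimes> c [^] a)" using assms by (simp add: m_assoc)
    also have "\<dots> = (f [^] m \<otimes> c [^] (a * q)) \<otimes> f" unfolding 1 using assms by (simp add: m_assoc)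
    also have "\<dots> = c [^] (a * q * q ^ m) \<otimes> f [^] Suc m" unfolding Suc using assms by (simp add: m_assoc)
    finally show ?case by (simp add: mult.assoc)
  qed (use assms in simp)
qed

text \<open>
  Let \<open>c\<^sup>p = 1\<close> and \<open>f\<^sup>q = 1\<close>, and let \<open>f\<close> act on \<open>\<langle>c\<rangle>\<close> as the \<open>q\<close>-th power map. If neither
  fixes a point, then the group that they generate is semiregular: an element \<open>c\<^sup>k f\<^sup>m\<close> with
  \<open>0 < m < q\<close> is conjugate to \<open>f\<^sup>m\<close>, because \<open>q\<^sup>m - 1\<close> is positive and smaller than \<open>p\<close>, hence
  invertible modulo \<open>p\<close>.
\<close>

lemma (in set_action) frobenius_group_semiregular:
  assumes c: "c \<in> carrier G" and f: "f \<in> carrier G" and rel: "f \<otimes> c = c [^] q \<otimes> f"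
    and cp: "c [^] p = \<one>" and fq: "f [^] q = \<one>"
    and pr: "prime p" "prime q" "q ^ (q - 1) < p"
    and no_fix: "\<And>x. x \<in> X \<Longrightarrow> act c x \<noteq> x" "\<And>x. x \<in> X \<Longrightarrow> act f x \<noteq> x"
    and ij: "i < p" "i' < p" "j < q" "j' < (q::nat)" and x: "x \<in> X"
    and eq: "act (c [^] i \<otimes> f [^] j) x = act (c [^] i' \<otimes> f [^] j') x"
  shows "i = i' \<and> j = j'"
proof -
  have moved: "act (c [^] (k::nat) \<otimes> f [^] m) x \<noteq> x" if "0 < m" "m < q" "x \<in> X" for k m x
  proof
    assume fix1: "act (c [^] k \<otimes> f [^] m) x = x"
    have q1: "1 < q" using pr(2) by (rule prime_gt_1_nat)
    have "q ^ m \<le> q ^ (q - 1)" using that q1 by (intro power_increasing) auto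
    then have lt: "q ^ m - 1 < p" using pr(3) by simp
    have "1 < q ^ m" using q1 \<open>0 < m\<close> by (rule one_less_power)
    then have "coprime (q ^ m - 1) p"
      using lt pr(1) by (metis coprime_commute nat_dvd_not_less prime_imp_coprime zero_less_diff)
    then obtain b where "[(q ^ m - 1) * b = 1] (mod p)" using cong_solve_coprime_nat by auto
    then have "[(q ^ m - 1) * b * k = 1 * k] (mod p)" by (rule cong_mult) simp
    then have cg: "[b * k * (q ^ m - 1) = k] (mod p)" by (simp add: ac_simps)
    \<comment> \<open>Now \<open>a * (q ^ m - 1)\<close> is congruent to \<open>k\<close>, so \<open>c ^ a\<close> conjugates \<open>c ^ k * f ^ m\<close> to \<open>f ^ m\<close>.\<close>
    define a where "a = b * k"
    have "c [^] (a * q ^ m) = c [^] (a + a * (q ^ m - 1))"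
      using \<open>1 < q ^ m\<close> by (simp add: algebra_simps)
    also have "\<dots> = c [^] a \<otimes> c [^] k"
      using c pow_mod_eq[OF c cp cg] by (simp add: a_def nat_pow_mult[symmetric])
    finally have "f [^] m \<otimes> c [^] a = c [^] a \<otimes> (c [^] k \<otimes> f [^] m)"
      using pow_normalizes[OF c f rel, of m a] c f by (simp add: m_assoc)
    then have "act (f [^] m) (act (c [^] a) x) = act (c [^] a) (act (c [^] k \<otimes> f [^] m) x)"
      using c f \<open>x \<in> X\<close> by (metis act_mult m_closed nat_pow_closed)
    then have "act (f [^] m) (act (c [^] a) x) = act (c [^] a) x" using fix1 by simp
    moreover have X: "act (c [^] a) x \<in> X" using c \<open>x \<in> X\<close> by (rule act_pow_closed)
    moreover have "coprime m q"
      using that pr(2) by (metis coprime_commute nat_dvd_not_less prime_imp_coprime)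
    ultimately have "act f (act (c [^] a) x) = act (c [^] a) x"
      using fixed_if_coprime_pow_fixed[OF f X, of m q] fq act_one[OF X] by simp
    with no_fix(2)[OF X] show False ..
  qed
  have moved_c: "act (c [^] (k::nat)) x \<noteq> x" if "\<not> p dvd k" "x \<in> X" for k x
  proof
    assume "act (c [^] k) x = x"
    moreover have "coprime k p" using that pr(1) by (metis coprime_commute prime_imp_coprime)
    ultimately have "act c x = x"
      using fixed_if_coprime_pow_fixed[OF c that(2), of k p] cp act_one[OF that(2)] by simp
    with no_fix(1)[OF that(2)] show False ..
  qed
  have main: "i = i' \<and> j = j'"
    if *: "i < p" "i' < p" "j \<le> j'" "j' < q"
      and eq: "act (c [^] i \<otimes> f [^] j) x = act (c [^] i' \<otimes> f [^] j') x" for i i' j j'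
  proof -
    define y where "y = act (f [^] j) x"
    have y: "y \<in> X" unfolding y_def using f x by (rule act_pow_closed)
    have "f [^] j' = f [^] (j' - j) \<otimes> f [^] j" using f * by (simp add: nat_pow_mult)
    then have "act (c [^] i) y = act (c [^] i') (act (f [^] (j' - j)) y)"
      using eq c f x by (simp add: act_mult y_def)
    then have "act (c [^] (p - i)) (act (c [^] i) y) =
        act (c [^] (p - i)) (act (c [^] i') (act (f [^] (j' - j)) y))" by simp
    moreover have "act (c [^] (p - i)) (act (c [^] i) y) = act (c [^] (p - i) \<otimes> c [^] i) y"
      using c y by (simp add: act_mult)
    moreover have "c [^] (p - i) \<otimes> c [^] i = \<one>" using c cp * by (simp add: nat_pow_mult)
    moreover have "act (c [^] (p - i)) (act (c [^] i') (act (f [^] (j' - j)) y)) =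
        act (c [^] (p - i) \<otimes> c [^] i' \<otimes> f [^] (j' - j)) y"
      using c f y act_pow_closed[OF f y] act_pow_closed[OF c] by (simp add: act_mult)
    ultimately have fixy: "act (c [^] (p - i + i') \<otimes> f [^] (j' - j)) y = y"
      using c act_one[OF y] by (simp add: nat_pow_mult)
    have jj: "j = j'"
    proof (rule ccontr)
      assume "j \<noteq> j'"
      with * have "0 < j' - j" "j' - j < q" by auto
      from moved[OF this y] fixy show False by blast
    qed
    then have "act (c [^] (p - i + i')) y = y" using fixy c by simp
    then have "p dvd p - i + i'" using moved_c y by blast
    then obtain k where k: "p - i + i' = p * k" by (auto simp: dvd_def)
    have "k \<noteq> 0" using k * by (intro notI) simp
    moreover have "k < 2"
    proof (rule ccontr)
      assume "\<not> k < 2"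
      then have "p * 2 \<le> p * k" by (intro mult_left_mono) auto
      then show False using k * by linarith
    qed
    ultimately have "k = 1" by simp
    then have "i = i'" using k * by simp
    with jj show ?thesis by simp
  qed
  show ?thesis
  proof (cases "j \<le> j'")
    case True then show ?thesis using main[OF ij(1,2) _ ij(4) eq] by simp
  next
    case False then show ?thesis using main[OF ij(2,1) _ ij(3) eq[symmetric]] by simp
  qed
qed

section \<open>Elementary transvections and elimination\<close>

lemma carrier_SL_iff: "A \<in> carrier (SL n) \<longleftrightarrow> A \<in> carrier_mat n n \<and> Determinant.det A = 1"
  by (simp add: SL_def)

lemma carrier_mat_if_SL: "A \<in> carrier (SL n) \<Longrightarrow> A \<in> carrier_mat n n"
  by (simp add: SL_def)

lemma mult_SL: "A \<otimes>\<^bsub>SL n\<^esub> B = A * B"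
  by (simp add: SL_def)

lemma one_SL: "\<one>\<^bsub>SL n\<^esub> = 1\<^sub>m n"
  by (simp add: SL_def)

lemma finite_carrier_mat: "finite (carrier_mat m n :: 'k::finite mat set)"
proof (rule finite_subset)
  show "carrier_mat m n \<subseteq> mat m n ` (({..<m} \<times> {..<n}) \<rightarrow>\<^sub>E (UNIV :: 'k set))"
  proof
    fix A :: "'k mat" assume A: "A \<in> carrier_mat m n"
    show "A \<in> mat m n ` (({..<m} \<times> {..<n}) \<rightarrow>\<^sub>E UNIV)"
    proof (rule image_eqI)
      show "A = mat m n (restrict (\<lambda>ij. A $$ ij) ({..<m} \<times> {..<n}))"
        using A by (intro eq_matI) auto
    qed auto
  qed
qed (simp add: finite_PiE)

lemma finite_carrier_SL: "finite (carrier (SL n :: 'k::{field,finite} mat monoid))"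
  by (rule finite_subset[OF _ finite_carrier_mat[of n n]]) (auto simp: SL_def)

lemma subgroup_SL_mult:
  assumes "subgroup S (SL n)" "A \<in> S" "B \<in> S"
  shows "A * B \<in> S"
  using subgroup.m_closed[OF assms] by (simp add: mult_SL)

lemma subgroup_SL_carrier:
  assumes "subgroup S (SL n)" "A \<in> S"
  shows "A \<in> carrier_mat n n" "Determinant.det A = 1"
  using subgroup.subset[OF assms(1)] assms(2) by (auto simp: SL_def)

lemma index_addrow_mat_mult:
  fixes B :: "'k::comm_ring_1 mat"
  assumes "B \<in> carrier_mat n m" "l < n" "i < n" "j < m"
  shows "(addrow_mat n a k l * B) $$ (i, j) =
    (if i = k then B $$ (i, j) + a * B $$ (l, j) else B $$ (i, j))"
proof -
  have "(addrow_mat n a k l * B) $$ (i, j) = addrow a k l B $$ (i, j)"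
    using addrow_mat[OF assms(1,2)] by simp
  then show ?thesis using assms by (simp add: add.commute)
qed

lemma addrow_mat_mult_carrier [simp]:
  "B \<in> carrier_mat n m \<Longrightarrow> addrow_mat n a k l * B \<in> carrier_mat n m"
  by (rule mult_carrier_mat[OF addrow_mat_carrier])

lemma addrow_mat_SL: "k \<noteq> l \<Longrightarrow> (addrow_mat n a k l :: 'k::field mat) \<in> carrier (SL n)"
  by (simp add: carrier_SL_iff det_addrow_mat)

text \<open>
  For \<open>k \<noteq> l\<close>, \<^term>\<open>addrow_mat n a k l\<close> is the elementary transvection \<open>1 + a E\<^sub>k\<^sub>l\<close>.
\<close>

lemma addrow_mat_add:
  assumes "k \<noteq> l" "l < n"
  shows "addrow_mat n a k l * addrow_mat n b k l = (addrow_mat n (a + b) k l :: 'k::field mat)"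
  using assms
  by (intro eq_matI) (auto simp: index_addrow_mat_mult[of _ n n] simp del: index_mult_mat(1))

lemma addrow_mat_zero: "k \<noteq> l \<Longrightarrow> addrow_mat n 0 k l = (1\<^sub>m n :: 'k::field mat)"
  by (intro eq_matI) auto

lemma addrow_mat_pow:
  assumes "k \<noteq> l" "l < n"
  shows "addrow_mat n a k l [^]\<^bsub>SL n\<^esub> (m::nat) = (addrow_mat n (of_nat m * a) k l :: 'k::field mat)"
proof (induction m)
  case 0 then show ?case using assms by (simp add: one_SL addrow_mat_zero)
next
  case (Suc m)
  interpret group "SL n :: 'k mat monoid" by (rule group_SL)
  show ?case using Suc assms by (simp add: mult_SL addrow_mat_add algebra_simps)
qed

lemma addrow_mat_commutator:
  fixes s t :: "'k::field"
  assumes "i < n" "j < n" "k < n" "i \<noteq> j" "i \<noteq> k" "j \<noteq> k"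
  shows "addrow_mat n s i k * addrow_mat n t k j =
      addrow_mat n (s * t) i j * (addrow_mat n t k j * addrow_mat n s i k)"
    and "addrow_mat n (s * t) i j * addrow_mat n s i k =
      addrow_mat n s i k * addrow_mat n (s * t) i j"
    and "addrow_mat n (s * t) i j * addrow_mat n t k j =
      addrow_mat n t k j * addrow_mat n (s * t) i j"
  using assms
  by (intro eq_matI; auto simp: index_addrow_mat_mult[of _ n n] algebra_simps
      simp del: index_mult_mat(1))+

text \<open>
  A representative \<open>w\<close> of the reflection that exchanges the coordinates \<open>k\<close> and \<open>l\<close> conjugates the two
  root subgroups into each other.
\<close>

lemma addrow_mat_weyl:
  fixes t :: "'k::field"
  assumes "k < n" "l < n" "k \<noteq> l"
  defines "w \<equiv> addrow_mat n 1 k l * (addrow_mat n (- 1) l k * addrow_mat n 1 k l)"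
  shows "addrow_mat n t l k * w = w * addrow_mat n (- t) k l"
proof -
  have "w * addrow_mat n (- t) k l =
    addrow_mat n 1 k l * (addrow_mat n (- 1) l k * (addrow_mat n 1 k l * addrow_mat n (- t) k l))"
    unfolding w_def by (simp add: assoc_mult_mat[of _ n n _ n _ n])
  moreover have "addrow_mat n t l k * w = \<dots>"
    unfolding w_def using assms(1-3)
    by (intro eq_matI) (auto simp: index_addrow_mat_mult[of _ n n] algebra_simps
      simp del: index_mult_mat(1))
  ultimately show ?thesis by simp
qed

text \<open>Clearing a column with a nonzero diagonal entry by row operations.\<close>

lemma clear_column:
  fixes A :: "'k::field mat"
  assumes A: "A \<in> carrier_mat n n" and k: "k < n" "A $$ (k, k) \<noteq> 0"
    and S: "subgroup S (SL n)"
    and el: "\<And>i t. \<lbrakk>i < n; i \<noteq> k; A $$ (i, k) \<noteq> 0\<rbrakk> \<Longrightarrow> addrow_mat n t i k \<in> S"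
  shows "\<exists>B\<in>S. \<forall>i<n. \<forall>j<n. (B * A) $$ (i, j) =
    (if i = k then A $$ (k, j) else A $$ (i, j) - A $$ (i, k) / A $$ (k, k) * A $$ (k, j))"
proof -
  have "\<exists>B\<in>S. \<forall>i<n. \<forall>j<n. (B * A) $$ (i, j) =
    (if i = k \<or> m \<le> i then A $$ (i, j) else A $$ (i, j) - A $$ (i, k) / A $$ (k, k) * A $$ (k, j))"
    if "m \<le> n" for m
    using that
  proof (induction m)
    case 0
    have "1\<^sub>m n \<in> S" using subgroup.one_closed[OF S] by (simp add: one_SL)
    moreover have "1\<^sub>m n * A = A" using A by simp
    ultimately show ?case by (intro bexI[of _ "1\<^sub>m n"]) auto
  next
    case (Suc m)
    then obtain B where B: "B \<in> S" "\<forall>i<n. \<forall>j<n. (B * A) $$ (i, j) =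
      (if i = k \<or> m \<le> i then A $$ (i, j) else A $$ (i, j) - A $$ (i, k) / A $$ (k, k) * A $$ (k, j))"
      by auto
    show ?case
    proof (cases "m = k \<or> A $$ (m, k) = 0")
      case True
      have "\<forall>i<n. \<forall>j<n. (B * A) $$ (i, j) =
        (if i = k \<or> Suc m \<le> i then A $$ (i, j)
         else A $$ (i, j) - A $$ (i, k) / A $$ (k, k) * A $$ (k, j))"
        using True B(2) by (auto simp: not_less_eq_eq le_antisym)
      then show ?thesis using B(1) by blast
    next
      case False
      let ?E = "addrow_mat n (- (A $$ (m, k) / A $$ (k, k))) m k"
      have E: "?E \<in> S" using False Suc.prems el by simp
      have Bc: "B \<in> carrier_mat n n" using subgroup_SL_carrier[OF S B(1)] by simp
      have "(?E * B) * A = ?E * (B * A)"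
        using A Bc by (simp add: assoc_mult_mat[of _ n n _ n _ n])
      moreover have "B * A \<in> carrier_mat n n" using A Bc by simp
      ultimately have "\<forall>i<n. \<forall>j<n. (?E * B * A) $$ (i, j) =
        (if i = k \<or> Suc m \<le> i then A $$ (i, j)
         else A $$ (i, j) - A $$ (i, k) / A $$ (k, k) * A $$ (k, j))"
        using B(2) False Suc.prems k
        by (auto simp: index_addrow_mat_mult[of _ n n] simp del: index_mult_mat(1))
      moreover have "?E * B \<in> S" using E B(1) by (rule subgroup_SL_mult[OF S])
      ultimately show ?thesis by blast
    qed
  qed
  from this[of n] obtain B where B: "B \<in> S" "\<forall>i<n. \<forall>j<n. (B * A) $$ (i, j) =
    (if i = k \<or> n \<le> i then A $$ (i, j) else A $$ (i, j) - A $$ (i, k) / A $$ (k, k) * A $$ (k, j))"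
    by auto
  then show ?thesis by (intro bexI[OF _ B(1)] allI impI) auto
qed

text \<open>
  If the first \<open>k\<close> columns are diagonal and column \<open>k\<close> vanishes from row \<open>k\<close> on, then the first
  \<open>k + 1\<close> columns are linearly dependent.
\<close>

lemma pivot_exists:
  fixes A :: "'k::field mat"
  assumes A: "A \<in> carrier_mat n n" "Determinant.det A \<noteq> 0" and k: "k < n"
    and diag: "\<And>i j. \<lbrakk>i < n; j < k; i \<noteq> j\<rbrakk> \<Longrightarrow> A $$ (i, j) = 0"
  shows "\<exists>i<n. k \<le> i \<and> A $$ (i, k) \<noteq> 0"
proof (rule ccontr)
  assume "\<not> ?thesis"
  then have zero: "A $$ (i, k) = 0" if "i < n" "k \<le> i" for i using that by blast
  have ne: "A $$ (j, j) \<noteq> 0" if "j < k" for j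
  proof
    assume "A $$ (j, j) = 0"
    then have "A $$ (i, j) = 0" if "i < n" for i using diag[of i j] that \<open>j < k\<close> by metis
    then have "A *\<^sub>v unit_vec n j = 0\<^sub>v n"
      using A k that by (intro eq_vecI) auto
    moreover have "unit_vec n j \<noteq> (0\<^sub>v n :: 'k vec)"
    proof
      assume "unit_vec n j = (0\<^sub>v n :: 'k vec)"
      then have "(unit_vec n j :: 'k vec) $ j = 0" using k that by simp
      then show False using k that by simp
    qed
    ultimately show False
      using A det_0_iff_vec_prod_zero_field[OF A(1)] by (metis unit_vec_carrier)
  qed
  define v where "v = vec n (\<lambda>j. if j = k then 1 else if j < k then - A $$ (j, k) / A $$ (j, j) else 0)"
  have "A *\<^sub>v v = 0\<^sub>v n"
  proof (rule eq_vecI)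
    fix i assume "i < dim_vec (0\<^sub>v n :: 'k vec)"
    then have i: "i < n" by simp
    have "(A *\<^sub>v v) $ i = (\<Sum>j<n. A $$ (i, j) * v $ j)"
      using A i by (simp add: scalar_prod_def v_def lessThan_atLeast0)
    also have "\<dots> = (\<Sum>j\<in>{i, k}. A $$ (i, j) * v $ j)"
      using i k diag by (intro sum.mono_neutral_right) (auto simp: v_def)
    also have "\<dots> = 0"
    proof (cases "i < k")
      case True then show ?thesis using i k ne by (simp add: v_def)
    next
      case False then show ?thesis using i k zero by (cases "i = k") (auto simp: v_def)
    qed
    finally show "(A *\<^sub>v v) $ i = 0\<^sub>v n $ i" using i by simp
  qed (use A in simp)
  moreover have "v \<in> carrier_vec n" by (simp add: v_def)
  moreover have "v \<noteq> 0\<^sub>v n"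
  proof
    assume "v = 0\<^sub>v n"
    then have "v $ k = 0" using k by simp
    then show False using k by (simp add: v_def)
  qed
  ultimately show False using A det_0_iff_vec_prod_zero_field[OF A(1)] by blast
qed

text \<open>
  The lower left block, with rows from \<open>d\<close> on and columns before \<open>d\<close>, is zero: the matrix leaves
  the span of the first \<open>d\<close> unit vectors invariant.
\<close>

definition block_upper :: "nat \<Rightarrow> 'k::zero mat \<Rightarrow> bool" where
  "block_upper d A \<longleftrightarrow> (\<forall>i<dim_row A. \<forall>j<dim_col A. d \<le> i \<longrightarrow> j < d \<longrightarrow> A $$ (i, j) = 0)"

text \<open>
  Gaussian elimination by those elementary transvections that are themselves block triangular.
\<close>

lemma block_upper_diagonalize:
  fixes A :: "'k::field mat"
  assumes A: "A \<in> carrier (SL n)" "block_upper d A"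
    and S: "subgroup S (SL n)"
    and el: "\<And>i j t. \<lbrakk>i < n; j < n; i \<noteq> j; i < d \<or> d \<le> j\<rbrakk> \<Longrightarrow> addrow_mat n t i j \<in> S"
  shows "\<exists>B\<in>S. diagonal_mat (B * A)"
proof -
  have "\<exists>B\<in>S. block_upper d (B * A) \<and> (\<forall>i<n. \<forall>j<k. i \<noteq> j \<longrightarrow> (B * A) $$ (i, j) = 0)"
    if "k \<le> n" for k
    using that
  proof (induction k)
    case 0
    have "1\<^sub>m n \<in> S" using subgroup.one_closed[OF S] by (simp add: one_SL)
    moreover have "1\<^sub>m n * A = A" using carrier_mat_if_SL[OF A(1)] by simp
    ultimately show ?case using A(2) by (intro bexI[of _ "1\<^sub>m n"]) auto
  next
    case (Suc k)
    then have k: "k < n" by simp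
    from Suc obtain B where B: "B \<in> S" "block_upper d (B * A)"
      "\<forall>i<n. \<forall>j<k. i \<noteq> j \<longrightarrow> (B * A) $$ (i, j) = 0" by auto
    have Ac: "A \<in> carrier_mat n n" "Determinant.det A = 1" using A by (auto simp: carrier_SL_iff)
    note Bc = subgroup_SL_carrier[OF S B(1)]
    define A1 where "A1 = B * A"
    have A1: "A1 \<in> carrier_mat n n" "Determinant.det A1 = 1"
      using Ac Bc by (auto simp: A1_def det_mult)
    have bu1: "A1 $$ (i, j) = 0" if "i < n" "d \<le> i" "j < d" "j < n" for i j
      using B(2) that A1(1) by (auto simp: block_upper_def A1_def[symmetric])
    have dg1: "A1 $$ (i, j) = 0" if "i < n" "j < k" "i \<noteq> j" for i j
      using B(3) that by (auto simp: A1_def)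
    have "\<exists>C\<in>S. (C * A1) $$ (k, k) \<noteq> 0 \<and> (\<forall>i<n. \<forall>j<n. d \<le> i \<and> j < d \<longrightarrow> (C * A1) $$ (i, j) = 0) \<and>
      (\<forall>i<n. \<forall>j<k. i \<noteq> j \<longrightarrow> (C * A1) $$ (i, j) = 0)"
    proof (cases "A1 $$ (k, k) = 0")
      case False
      have "1\<^sub>m n \<in> S" using subgroup.one_closed[OF S] by (simp add: one_SL)
      moreover have "1\<^sub>m n * A1 = A1" using A1 by simp
      ultimately show ?thesis using False bu1 dg1 by (intro bexI[of _ "1\<^sub>m n"]) auto
    next
      case True
      \<comment> \<open>Adding row \<open>i\<close> to row \<open>k\<close> is allowed: the block shape puts \<open>i\<close> and \<open>k\<close> on the same side of \<open>d\<close>.\<close>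
      obtain i where i: "i < n" "k \<le> i" "A1 $$ (i, k) \<noteq> 0"
        using pivot_exists[of A1 n k] A1 k dg1 by auto
      with True have ik: "k < i" by (metis le_neq_implies_less)
      have al: "k < d \<or> d \<le> i" using i ik by linarith
      have "i < d" if "k < d" using bu1[of i k] i k that by (meson not_le)
      then have "addrow_mat n 1 k i \<in> S" using el[of k i] i ik k al by auto
      moreover have "(addrow_mat n 1 k i * A1) $$ (k, k) \<noteq> 0"
        using i k True A1 by (simp add: index_addrow_mat_mult[of _ n n] del: index_mult_mat(1))
      moreover have "\<forall>a<n. \<forall>b<n. d \<le> a \<and> b < d \<longrightarrow> (addrow_mat n 1 k i * A1) $$ (a, b) = 0"
        using i ik k A1 bu1 by (auto simp: index_addrow_mat_mult[of _ n n] simp del: index_mult_mat(1))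
      moreover have "\<forall>a<n. \<forall>b<k. a \<noteq> b \<longrightarrow> (addrow_mat n 1 k i * A1) $$ (a, b) = 0"
        using i ik k A1 dg1 by (auto simp: index_addrow_mat_mult[of _ n n] simp del: index_mult_mat(1))
      ultimately show ?thesis by blast
    qed
    then obtain C where C: "C \<in> S" "(C * A1) $$ (k, k) \<noteq> 0"
      "\<forall>i<n. \<forall>j<n. d \<le> i \<and> j < d \<longrightarrow> (C * A1) $$ (i, j) = 0"
      "\<forall>i<n. \<forall>j<k. i \<noteq> j \<longrightarrow> (C * A1) $$ (i, j) = 0" by blast
    note Cc = subgroup_SL_carrier[OF S C(1)]
    define A2 where "A2 = C * A1"
    have A2: "A2 \<in> carrier_mat n n" using A1 Cc by (auto simp: A2_def)
    have "addrow_mat n t i k \<in> S" if "i < n" "i \<noteq> k" "A2 $$ (i, k) \<noteq> 0" for i t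
    proof -
      have "i < d \<or> d \<le> k" using C(3) that k unfolding A2_def by (meson not_le)
      then show ?thesis using el that k by simp
    qed
    then obtain D where D: "D \<in> S" "\<forall>i<n. \<forall>j<n. (D * A2) $$ (i, j) =
      (if i = k then A2 $$ (k, j) else A2 $$ (i, j) - A2 $$ (i, k) / A2 $$ (k, k) * A2 $$ (k, j))"
      using clear_column[OF A2 k _ S] C(2) unfolding A2_def[symmetric] by blast
    note Dc = subgroup_SL_carrier[OF S D(1)]
    have eq: "D * (C * B) * A = D * A2"
      using Ac Bc Cc Dc by (simp add: A2_def A1_def assoc_mult_mat[of _ n n _ n _ n])
    have DA2: "D * A2 \<in> carrier_mat n n" using Dc A2 by simp
    have "\<forall>i<n. \<forall>j<n. d \<le> i \<and> j < d \<longrightarrow> (D * A2) $$ (i, j) = 0"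
    proof (intro allI impI)
      fix i j assume *: "i < n" "j < n" "d \<le> i \<and> j < d"
      have "A2 $$ (i, k) * A2 $$ (k, j) = 0"
        using C(3) * k unfolding A2_def by (cases "k < d") auto
      then show "(D * A2) $$ (i, j) = 0"
        using C(3) * k unfolding D(2)[rule_format, OF *(1,2)] A2_def[symmetric] by auto
    qed
    then have "block_upper d (D * A2)"
      using DA2 by (auto simp: block_upper_def simp del: index_mult_mat)
    moreover have "\<forall>i<n. \<forall>j<Suc k. i \<noteq> j \<longrightarrow> (D * A2) $$ (i, j) = 0"
    proof (intro allI impI)
      fix i j assume *: "i < n" "j < Suc k" "i \<noteq> j"
      then have "j < n" using k by simp
      show "(D * A2) $$ (i, j) = 0"
      proof (cases "j = k")
        case True
        then show ?thesis using D(2)[rule_format, OF *(1) \<open>j < n\<close>] C(2) * by (simp add: A2_def)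
      next
        case False
        then have "A2 $$ (i, j) = 0" "A2 $$ (k, j) = 0"
          using C(4) * k unfolding A2_def by auto
        then show ?thesis using D(2)[rule_format, OF *(1) \<open>j < n\<close>] by simp
      qed
    qed
    moreover have "D * (C * B) \<in> S" using B C D by (meson S subgroup_SL_mult)
    ultimately show ?case using eq by metis
  qed
  from this[of n] obtain B where B: "B \<in> S"
    "\<forall>i<n. \<forall>j<n. i \<noteq> j \<longrightarrow> (B * A) $$ (i, j) = 0" by auto
  then have "diagonal_mat (B * A)"
    using A subgroup_SL_carrier[OF S B(1)] by (auto simp: diagonal_mat_def carrier_SL_iff)
  with B(1) show ?thesis ..
qed

text \<open>
  The entry \<open>(a, a + 1)\<close> is additive on upper unitriangular matrices; those where it vanishes are
  products of elementary transvections other than the ones at that position.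
\<close>

lemma unitriangular_mem_subgroup:
  fixes A :: "'k::field mat"
  assumes A: "A \<in> carrier (SL n)" "\<And>i. i < n \<Longrightarrow> A $$ (i, i) = 1"
      "\<And>i j. \<lbrakk>i < n; j < i\<rbrakk> \<Longrightarrow> A $$ (i, j) = 0"
    and a: "Suc a < n" "A $$ (a, Suc a) = 0"
    and S: "subgroup S (SL n)"
    and el: "\<And>i j t. \<lbrakk>i < j; j < n; (i, j) \<noteq> (a, Suc a)\<rbrakk> \<Longrightarrow> addrow_mat n t i j \<in> S"
  shows "A \<in> S"
proof -
  have Ac: "A \<in> carrier_mat n n" using A by (auto simp: carrier_SL_iff)
  have "\<exists>B\<in>S. (B * A) $$ (a, Suc a) = 0 \<and> (\<forall>i<n. (B * A) $$ (i, i) = 1) \<and>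
     (\<forall>i<n. \<forall>j<n. j < i \<or> (j < k \<and> i \<noteq> j) \<longrightarrow> (B * A) $$ (i, j) = 0)"
    if "k \<le> n" for k
    using that
  proof (induction k)
    case 0
    have "1\<^sub>m n \<in> S" using subgroup.one_closed[OF S] by (simp add: one_SL)
    moreover have "1\<^sub>m n * A = A" using Ac by simp
    ultimately show ?case using A a by (intro bexI[of _ "1\<^sub>m n"]) auto
  next
    case (Suc k)
    then have k: "k < n" by simp
    from Suc obtain B where B: "B \<in> S" "(B * A) $$ (a, Suc a) = 0" "\<forall>i<n. (B * A) $$ (i, i) = 1"
     "\<forall>i<n. \<forall>j<n. j < i \<or> (j < k \<and> i \<noteq> j) \<longrightarrow> (B * A) $$ (i, j) = 0" by auto
    note Bc = subgroup_SL_carrier[OF S B(1)]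
    define A1 where "A1 = B * A"
    note B' = B(2-4)[folded A1_def]
    have A1: "A1 \<in> carrier_mat n n" using Ac Bc by (auto simp: A1_def)
    have "addrow_mat n t i k \<in> S" if "i < n" "i \<noteq> k" "A1 $$ (i, k) \<noteq> 0" for i t
    proof -
      have "\<not> k < i" using B'(3) that k by blast
      moreover have "(i, k) \<noteq> (a, Suc a)" using B'(1) that by auto
      ultimately show ?thesis using el that k by auto
    qed
    then obtain D where D: "D \<in> S" "\<forall>i<n. \<forall>j<n. (D * A1) $$ (i, j) =
      (if i = k then A1 $$ (k, j) else A1 $$ (i, j) - A1 $$ (i, k) / A1 $$ (k, k) * A1 $$ (k, j))"
      using clear_column[OF A1 k _ S] B'(2) k by fastforce
    note Dc = subgroup_SL_carrier[OF S D(1)]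
    have eq: "D * B * A = D * A1"
      using Ac Bc Dc by (simp add: A1_def assoc_mult_mat[of _ n n _ n _ n])
    have ent: "(D * A1) $$ (i, j) =
      (if i = k then A1 $$ (k, j) else A1 $$ (i, j) - A1 $$ (i, k) * A1 $$ (k, j))"
      if "i < n" "j < n" for i j using D(2) that B'(2) k by simp
    have "A1 $$ (a, k) * A1 $$ (k, Suc a) = 0" if "a \<noteq> k"
    proof -
      consider "k < a" | "k = Suc a" | "Suc a < k" using \<open>a \<noteq> k\<close> by linarith
      then show ?thesis using B'(1,3) a k by cases auto
    qed
    then have "(D * A1) $$ (a, Suc a) = 0" using ent[of a "Suc a"] a B'(1) by auto
    moreover have "(D * A1) $$ (i, i) = 1" if "i < n" for i
    proof -
      have "A1 $$ (i, k) * A1 $$ (k, i) = 0" if "i \<noteq> k"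
        using B'(3) k \<open>i < n\<close> that by (cases "i < k") auto
      then show ?thesis using ent[of i i] B'(2) k that by auto
    qed
    moreover have "(D * A1) $$ (i, j) = 0" if "i < n" "j < n" "j < i \<or> j < Suc k \<and> i \<noteq> j" for i j
    proof (cases "j = k")
      case True
      then show ?thesis using ent[of i j] that B'(2) k by auto
    next
      case False
      then have "j < i \<or> (j < k \<and> i \<noteq> j)" using that by auto
      then have z: "A1 $$ (i, j) = 0" using B'(3) that by blast
      have "A1 $$ (i, k) * A1 $$ (k, j) = 0" if "i \<noteq> k"
      proof (cases "j < k")
        case True
        then show ?thesis using B'(3) k \<open>j < n\<close> by simp
      next
        case False
        then have "k < i" using \<open>j < i \<or> (j < k \<and> i \<noteq> j)\<close> by auto
        then show ?thesis using B'(3) k \<open>i < n\<close> by simp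
      qed
      then show ?thesis using ent[of i j] z that by auto
    qed
    moreover have "D * B \<in> S" using B D by (meson S subgroup_SL_mult)
    ultimately show ?case using eq by metis
  qed
  from this[of n] obtain B where B: "B \<in> S" "\<forall>i<n. (B * A) $$ (i, i) = 1"
    "\<forall>i<n. \<forall>j<n. i \<noteq> j \<longrightarrow> (B * A) $$ (i, j) = 0" by auto
  interpret group "SL n :: 'k mat monoid" by (rule group_SL)
  have "B * A = 1\<^sub>m n"
    using B(2,3) Ac subgroup_SL_carrier[OF S B(1)] by (intro eq_matI) auto
  then have "B \<otimes>\<^bsub>SL n\<^esub> A = \<one>\<^bsub>SL n\<^esub>" by (simp add: mult_SL one_SL)
  then have "A = inv\<^bsub>SL n\<^esub> B"
    using A(1) subgroup.mem_carrier[OF S B(1)] by (metis inv_comm inv_equality)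
  then show ?thesis using subgroup.m_inv_closed[OF S B(1)] by simp
qed

section \<open>Two generators of a Frobenius group of order pq\<close>

lemma set_action_columns: "set_action (SL n :: 'k::field mat monoid) (carrier_mat n 1) (*)"
proof -
  interpret group "SL n :: 'k mat monoid" by (rule group_SL)
  show ?thesis
    by unfold_locales (auto simp: carrier_SL_iff mult_SL one_SL intro: assoc_mult_mat)
qed

text \<open>
  The \<open>j\<close>-th unit vector as a matrix with one column. Vectors are one-column matrices throughout
  and linear forms one-row matrices, so that all products are matrix products.
\<close>

definition unit_col :: "nat \<Rightarrow> nat \<Rightarrow> 'k::zero_neq_one mat" where
  "unit_col n j = mat n 1 (\<lambda>(i, _). if i = j then 1 else 0)"

lemma unit_col_carrier [simp]: "unit_col n j \<in> carrier_mat n 1"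
  by (simp add: unit_col_def)

lemmas unit_col_carrier_Suc [simp] = unit_col_carrier[unfolded One_nat_def]

lemma one_mult_unit_col [simp]: "1\<^sub>m n * unit_col n j = (unit_col n j :: 'k::semiring_1 mat)"
  by (rule left_mult_one_mat[OF unit_col_carrier])

lemma index_mult_unit_col:
  fixes A :: "'k::comm_ring_1 mat"
  assumes "A \<in> carrier_mat n n" "i < n" "j < n"
  shows "(A * unit_col n j) $$ (i, 0) = A $$ (i, j)"
proof -
  have "(A * unit_col n j) $$ (i, 0) = (\<Sum>k\<in>{..<n}. A $$ (i, k) * (if k = j then 1 else 0))"
    using assms by (simp add: scalar_prod_def unit_col_def lessThan_atLeast0)
  also have "\<dots> = A $$ (i, j)" using assms(3) by (simp add: if_distrib cong: if_cong)
  finally show ?thesis .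
qed

lemma eq_mat_unit_colI:
  fixes A B :: "'k::comm_ring_1 mat"
  assumes "A \<in> carrier_mat n n" "B \<in> carrier_mat n n"
    and "\<And>j. j < n \<Longrightarrow> A * unit_col n j = B * unit_col n j"
  shows "A = B"
proof (rule eq_matI)
  fix i j assume "i < dim_row B" "j < dim_col B"
  then show "A $$ (i, j) = B $$ (i, j)"
    using assms index_mult_unit_col[of A n i j] index_mult_unit_col[of B n i j] by simp
qed (use assms in auto)

lemma index_mult_col:
  fixes A :: "'k::comm_ring_1 mat"
  assumes "A \<in> carrier_mat n n" "v \<in> carrier_mat n 1" "i < n"
  shows "(A * v) $$ (i, 0) = (\<Sum>j<n. A $$ (i, j) * v $$ (j, 0))"
  using assms by (simp add: scalar_prod_def lessThan_atLeast0)

text \<open>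
  A field with \<open>q\<close> elements, \<open>q\<close> an odd prime.
\<close>

locale odd_prime_field =
  fixes q :: nat and ty :: "'k::{field,finite} itself"
  assumes prime_q: "prime q" and odd_q: "odd q" and card_k: "card (UNIV :: 'k set) = q"
begin

lemma q_ge_3: "3 \<le> q"
  using prime_q odd_q prime_ge_2_nat[of q] by (cases "q = 2") auto

lemma CHAR_k: "CHAR('k) = q"
proof -
  have "CHAR('k) dvd q" using CHAR_dvd_CARD[where ?'a = 'k] card_k by simp
  moreover have "CHAR('k) \<noteq> 1" by simp
  ultimately show ?thesis using prime_q by (metis prime_nat_iff)
qed

lemma of_nat_q: "of_nat q = (0 :: 'k)"
  using of_nat_CHAR[where ?'a = 'k] by (simp add: CHAR_k)

lemma of_nat_eq_0_k: "of_nat m = (0 :: 'k) \<longleftrightarrow> q dvd m"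
  by (simp add: of_nat_eq_0_iff_char_dvd CHAR_k)

lemma of_nat_neq_0: "\<lbrakk>0 < m; m < q\<rbrakk> \<Longrightarrow> of_nat m \<noteq> (0 :: 'k)"
  using of_nat_eq_0_k nat_dvd_not_less by blast

lemma ex_of_nat: "\<exists>m. x = (of_nat m :: 'k)"
proof -
  have "inj_on (of_nat :: nat \<Rightarrow> 'k) {..<q}"
  proof (rule linorder_inj_onI)
    fix m n :: nat assume *: "m < n" "m \<in> {..<q}" "n \<in> {..<q}"
    then have "of_nat (n - m) \<noteq> (0 :: 'k)" by (intro of_nat_neq_0) auto
    then show "of_nat m \<noteq> (of_nat n :: 'k)" using * by (simp add: of_nat_diff)
  qed auto
  then have "card ((of_nat :: nat \<Rightarrow> 'k) ` {..<q}) = card (UNIV :: 'k set)"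
    by (simp add: card_image card_k)
  then have "(of_nat :: nat \<Rightarrow> 'k) ` {..<q} = UNIV"
    by (intro card_subset_eq) auto
  then show ?thesis by (metis UNIV_I imageE)
qed

lemma power_q: "x ^ q = (x :: 'k)"
proof -
  obtain m where m: "x = of_nat m" using ex_of_nat by blast
  have "[m ^ q = m] (mod q)"
  proof (cases "q dvd m")
    case True
    then have "q dvd m ^ q" using q_ge_3 by (intro dvd_trans[OF True] dvd_power) auto
    with True show ?thesis by (simp add: cong_def)
  next
    case False
    then have "[m ^ (q - 1) * m = 1 * m] (mod q)"
      using fermat_theorem[OF prime_q] by (intro cong_mult) auto
    moreover have "m ^ (q - 1) * m = m ^ q"
      using q_ge_3 by (simp flip: power_Suc2)
    ultimately show ?thesis by simp
  qed
  then show ?thesis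
    using of_nat_eq_iff_cong_CHAR[where ?'a = 'k, of "m ^ q" m] by (simp add: m CHAR_k)
qed

text \<open>
  The companion matrix of \<open>X\<^sup>q - X - 1\<close>: multiplication by \<open>X\<close> with respect to the basis
  \<open>1, X, \<dots>, X\<^sup>q\<^sup>-\<^sup>1\<close> of \<open>k[X] / (X\<^sup>q - X - 1)\<close>.
\<close>

definition artin_schreier :: "'k mat" where
  "artin_schreier =
    mat q q (\<lambda>(i, j). if i = Suc j \<or> (Suc j = q \<and> i \<le> 1) then 1 else 0)"

text \<open>
  The matrix of the algebra automorphism \<open>X \<mapsto> X + 1\<close> with respect to the same basis, by the
  binomial theorem. It is upper unitriangular, with entries \<open>1, \<dots>, q - 1\<close> above the diagonal; so it
  is a single unipotent Jordan block.
\<close>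

definition pascal :: "'k mat" where
  "pascal = mat q q (\<lambda>(i, j). of_nat (j choose i))"

lemma artin_schreier_carrier: "artin_schreier \<in> carrier_mat q q"
  by (simp add: artin_schreier_def)

lemma pascal_carrier: "pascal \<in> carrier_mat q q"
  by (simp add: pascal_def)

lemma pascal_SL: "pascal \<in> carrier (SL q)"
proof -
  have "upper_triangular pascal" by (auto simp: pascal_def binomial_eq_0)
  then have "Determinant.det pascal = prod_list (diag_mat pascal)"
    using det_upper_triangular pascal_carrier by blast
  also have "diag_mat pascal = map (\<lambda>_. 1) [0..<q]"
    by (auto simp: diag_mat_def pascal_def)
  also have "prod_list \<dots> = (1 :: 'k)" by (induction q) auto
  finally show ?thesis by (simp add: carrier_SL_iff pascal_carrier)
qed

lemma artin_schreier_SL: "artin_schreier \<in> carrier (SL q)"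
proof -
  have "Determinant.det artin_schreier =
      (\<Sum>j<q. artin_schreier $$ (0, j) * cofactor artin_schreier 0 j)"
    using q_ge_3 by (intro laplace_expansion_row artin_schreier_carrier) auto
  also have "\<dots> = (\<Sum>j\<in>{q - 1}. artin_schreier $$ (0, j) * cofactor artin_schreier 0 j)"
    using q_ge_3 by (intro sum.mono_neutral_right) (auto simp: artin_schreier_def)
  also have "\<dots> = cofactor artin_schreier 0 (q - 1)"
    using q_ge_3 by (simp add: artin_schreier_def)
  also have "mat_delete artin_schreier 0 (q - 1) = 1\<^sub>m (q - 1)"
    using q_ge_3 by (intro eq_matI) (auto simp: mat_delete_def artin_schreier_def)
  then have "cofactor artin_schreier 0 (q - 1) = 1"
    using odd_q by (simp add: cofactor_def)
  finally show ?thesis by (simp add: carrier_SL_iff artin_schreier_carrier)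
qed

sublocale sl: group "SL q :: 'k mat monoid" by (rule group_SL)

sublocale cols: set_action "SL q :: 'k mat monoid" "carrier_mat q 1" "(*)"
  by (rule set_action_columns)

lemma artin_schreier_unit_col:
  "Suc j < q \<Longrightarrow> artin_schreier * unit_col q j = unit_col q (Suc j)"
proof (rule eq_matI)
  fix i k assume "Suc j < q" "i < dim_row (unit_col q (Suc j) :: 'k mat)"
    "k < dim_col (unit_col q (Suc j) :: 'k mat)"
  then show "(artin_schreier * unit_col q j) $$ (i, k) = unit_col q (Suc j) $$ (i, k)"
    using index_mult_unit_col[OF artin_schreier_carrier, of i j]
    by (simp add: unit_col_def artin_schreier_def)
qed (auto simp: unit_col_def artin_schreier_def)

lemma artin_schreier_unit_col_last:
  "artin_schreier * unit_col q (q - 1) = unit_col q 0 + unit_col q 1"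
proof (rule eq_matI)
  fix i k assume "i < dim_row (unit_col q 0 + unit_col q 1 :: 'k mat)"
    "k < dim_col (unit_col q 0 + unit_col q 1 :: 'k mat)"
  then show "(artin_schreier * unit_col q (q - 1)) $$ (i, k) =
      (unit_col q 0 + unit_col q 1) $$ (i, k)"
    using index_mult_unit_col[OF artin_schreier_carrier, of i "q - 1"] q_ge_3
    by (auto simp: unit_col_def artin_schreier_def)
qed (auto simp: unit_col_def artin_schreier_def)

lemma artin_schreier_pow_unit_col:
  "j < q \<Longrightarrow> artin_schreier [^]\<^bsub>SL q\<^esub> j * unit_col q 0 = unit_col q j"
proof (induction j)
  case 0 then show ?case by (simp add: one_SL)
next
  case (Suc j)
  have "artin_schreier [^]\<^bsub>SL q\<^esub> Suc j * unit_col q 0 =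
      artin_schreier * (artin_schreier [^]\<^bsub>SL q\<^esub> j * unit_col q 0)"
    using cols.act_mult[of artin_schreier "artin_schreier [^]\<^bsub>SL q\<^esub> j" "unit_col q 0"]
      sl.nat_pow_Suc2[OF artin_schreier_SL, of j] artin_schreier_SL
    by (simp del: Group.nat_pow_Suc)
  then show ?case using Suc by (simp add: artin_schreier_unit_col)
qed

text \<open>A matrix commuting with the companion matrix is determined by its first column.\<close>

lemma eq_if_commute_artin_schreier:
  assumes A: "A \<in> carrier_mat q q" and B: "B \<in> carrier_mat q q"
    and "A * artin_schreier = artin_schreier * A" "B * artin_schreier = artin_schreier * B"
    and first: "A * unit_col q 0 = B * unit_col q 0"
  shows "A = B"
proof (rule eq_mat_unit_colI[OF A B])
  fix j assume "j < q"
  then show "A * unit_col q j = B * unit_col q j"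
  proof (induction j)
    case (Suc j)
    have "C * unit_col q (Suc j) = artin_schreier * (C * unit_col q j)"
      if "C * artin_schreier = artin_schreier * C" "C \<in> carrier_mat q q" for C
    proof -
      have "C * unit_col q (Suc j) = C * (artin_schreier * unit_col q j)"
        using Suc.prems by (simp add: artin_schreier_unit_col)
      also have "\<dots> = (C * artin_schreier) * unit_col q j"
        using that(2) artin_schreier_carrier by (simp add: assoc_mult_mat[of _ q q _ q _ 1])
      also have "\<dots> = artin_schreier * (C * unit_col q j)"
        unfolding that(1) by (rule assoc_mult_mat[OF artin_schreier_carrier that(2) unit_col_carrier])
      finally show ?thesis .
    qed
    then show ?case using assms Suc by simp
  qed (rule first)
qed

lemma artin_schreier_pow_commute:
  "artin_schreier [^]\<^bsub>SL q\<^esub> (m::nat) * artin_schreier =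
    artin_schreier * artin_schreier [^]\<^bsub>SL q\<^esub> m"
  using sl.nat_pow_Suc2[OF artin_schreier_SL, of m] by (simp add: mult_SL)

lemma artin_schreier_pow_carrier: "artin_schreier [^]\<^bsub>SL q\<^esub> (m::nat) \<in> carrier_mat q q"
  using sl.nat_pow_closed[OF artin_schreier_SL] by (rule carrier_mat_if_SL)

text \<open>
  This is the relation \<open>X\<^sup>q = X + 1\<close>.
\<close>

lemma artin_schreier_pow_q: "artin_schreier [^]\<^bsub>SL q\<^esub> q = artin_schreier + 1\<^sub>m q"
proof (rule eq_if_commute_artin_schreier)
  have "artin_schreier [^]\<^bsub>SL q\<^esub> q * unit_col q 0 =
      artin_schreier * (artin_schreier [^]\<^bsub>SL q\<^esub> (q - 1) * unit_col q 0)"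
    using cols.act_mult[of artin_schreier "artin_schreier [^]\<^bsub>SL q\<^esub> (q - 1)" "unit_col q 0"]
      sl.nat_pow_Suc2[OF artin_schreier_SL, of "q - 1"] artin_schreier_SL q_ge_3
    by (simp del: Group.nat_pow_Suc)
  also have "\<dots> = unit_col q 0 + unit_col q 1"
    using q_ge_3 artin_schreier_pow_unit_col[of "q - 1"] artin_schreier_unit_col_last by simp
  also have "\<dots> = unit_col q 1 + unit_col q 0" by (rule comm_add_mat[of _ q 1]) auto
  also have "\<dots> = (artin_schreier + 1\<^sub>m q) * unit_col q 0"
    using q_ge_3 artin_schreier_unit_col[of 0] artin_schreier_carrier
    by (simp add: add_mult_distrib_mat[of _ q q _ _ 1])
  finally show "artin_schreier [^]\<^bsub>SL q\<^esub> q * unit_col q 0 = \<dots>" .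
  show "(artin_schreier + 1\<^sub>m q) * artin_schreier = artin_schreier * (artin_schreier + 1\<^sub>m q)"
    using artin_schreier_carrier
    by (simp add: add_mult_distrib_mat[of _ q q _ _ q] mult_add_distrib_mat[of _ q q _ q])
qed (use artin_schreier_carrier artin_schreier_pow_carrier artin_schreier_pow_commute in auto)

text \<open>
  The automorphism maps \<open>X\<close> to \<open>X + 1 = X\<^sup>q\<close>.
\<close>

lemma pascal_artin_schreier:
  "pascal * artin_schreier = artin_schreier [^]\<^bsub>SL q\<^esub> q * pascal"
proof -
  have "pascal * artin_schreier = artin_schreier * pascal + pascal"
  proof (rule eq_matI)
    fix i j assume "i < dim_row (artin_schreier * pascal + pascal)"
      "j < dim_col (artin_schreier * pascal + pascal)"
    then have ij: "i < q" "j < q" using pascal_carrier artin_schreier_carrier by auto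
    have P: "pascal $$ (i, j) = of_nat (j choose i)" using ij by (simp add: pascal_def)
    have S: "(artin_schreier * pascal + pascal) $$ (i, j) =
        (artin_schreier * pascal) $$ (i, j) + of_nat (j choose i)"
      using ij pascal_carrier by (simp add: P del: index_mult_mat(1))
    have L: "(pascal * artin_schreier) $$ (i, j) = (\<Sum>k<q. pascal $$ (i, k) * artin_schreier $$ (k, j))"
      using ij pascal_carrier artin_schreier_carrier by (simp add: scalar_prod_def lessThan_atLeast0)
    have R: "(artin_schreier * pascal) $$ (i, j) = (\<Sum>k<q. artin_schreier $$ (i, k) * pascal $$ (k, j))"
      using ij pascal_carrier artin_schreier_carrier by (simp add: scalar_prod_def lessThan_atLeast0)
    have R2: "(\<Sum>k<q. artin_schreier $$ (i, k) * pascal $$ (k, j)) =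
      (if i = 0 then 0 else of_nat (j choose (i - 1))) + (if i \<le> 1 \<and> Suc j = q then 1 else 0)"
    proof -
      have "(\<Sum>k<q. artin_schreier $$ (i, k) * pascal $$ (k, j)) =
        (\<Sum>k<q. (if i = Suc k then of_nat (j choose k) else 0) +
          (if k = q - 1 then (if i \<le> 1 then of_nat (j choose (q - 1)) else 0) else 0))"
        using ij q_ge_3 by (intro sum.cong) (auto simp: artin_schreier_def pascal_def)
      also have "\<dots> = (\<Sum>k<q. if i = Suc k then of_nat (j choose k) else 0) +
          (if i \<le> 1 then of_nat (j choose (q - 1)) else 0)"
        using q_ge_3 by (simp add: sum.distrib)
      also have "(\<Sum>k<q. if i = Suc k then of_nat (j choose k) else 0) =
          (if i = 0 then 0 else of_nat (j choose (i - 1)) :: 'k)"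
      proof (cases i)
        case (Suc l)
        then have "(\<Sum>k<q. if i = Suc k then of_nat (j choose k) else 0) =
          (\<Sum>k<q. if k = l then of_nat (j choose k) else (0::'k))"
          by (intro sum.cong) auto
        then show ?thesis using Suc ij by simp
      qed simp
      also have "(j choose (q - 1)) = (if Suc j = q then 1 else 0)"
        using ij by (auto simp: binomial_eq_0)
      finally show ?thesis by simp
    qed
    show "(pascal * artin_schreier) $$ (i, j) = (artin_schreier * pascal + pascal) $$ (i, j)"
    proof (cases "Suc j = q")
      case False
      then have "Suc j < q" using ij by simp
      have "(\<Sum>k<q. pascal $$ (i, k) * artin_schreier $$ (k, j)) =
          (\<Sum>k<q. if k = Suc j then of_nat (Suc j choose i) else 0)"
        using ij False by (intro sum.cong) (auto simp: artin_schreier_def pascal_def)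
      also have "\<dots> = of_nat (Suc j choose i)" using \<open>Suc j < q\<close> by simp
      also have "\<dots> = (if i = 0 then 0 else of_nat (j choose (i - 1))) + of_nat (j choose i)"
        by (cases i) auto
      finally show ?thesis
        unfolding L S R R2 using False by simp
    next
      case True
      have "(\<Sum>k<q. pascal $$ (i, k) * artin_schreier $$ (k, j)) =
          (\<Sum>k\<in>{0, 1}. pascal $$ (i, k) * artin_schreier $$ (k, j))"
        using ij True q_ge_3 by (intro sum.mono_neutral_right) (auto simp: artin_schreier_def)
      also have "\<dots> = of_nat (0 choose i) + of_nat (1 choose i)"
        using ij True q_ge_3 by (simp add: artin_schreier_def pascal_def)
      finally have L2: "(pascal * artin_schreier) $$ (i, j) = of_nat (0 choose i) + of_nat (1 choose i)"
        unfolding L .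
      have "of_nat (0 choose i) + of_nat (1 choose i) =
        (if i = 0 then 0 else of_nat (j choose (i - 1))) + (if i \<le> 1 then 1 else 0) +
          (of_nat (j choose i) :: 'k)"
        if "i \<noteq> 0"
      proof -
        obtain l where l: "i = Suc l" using \<open>i \<noteq> 0\<close> by (cases i) auto
        have "(j choose l) + (j choose i) = (q choose i)" using True l by auto
        moreover have "q dvd (q choose i)"
          using prime_q \<open>i \<noteq> 0\<close> ij by (intro dvd_choose_prime) auto
        then have "of_nat (q choose i) = (0 :: 'k)" by (simp add: of_nat_eq_0_k)
        ultimately have z: "of_nat (j choose l) + of_nat (j choose i) = (0 :: 'k)"
          by (metis of_nat_add)
        have e: "of_nat (0 choose i) + of_nat (1 choose i) = (if i \<le> 1 then 1 else 0 :: 'k)"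
          using l by (cases l) auto
        have "(if i = 0 then 0 else of_nat (j choose (i - 1))) + (if i \<le> 1 then 1 else 0) +
            (of_nat (j choose i) :: 'k) =
          (of_nat (j choose l) + of_nat (j choose i)) + (if i \<le> 1 then 1 else 0)"
          using l by (simp add: ac_simps)
        then show ?thesis unfolding z e by simp
      qed
      then show ?thesis
        unfolding L2 S R R2 using True by (cases "i = 0") simp_all
    qed
  qed (use pascal_carrier artin_schreier_carrier in auto)
  also have "\<dots> = (artin_schreier + 1\<^sub>m q) * pascal"
    using pascal_carrier artin_schreier_carrier by (simp add: add_mult_distrib_mat[of _ q q _ _ q])
  finally show ?thesis by (simp add: artin_schreier_pow_q)
qed

lemma pascal_unit_col_0: "pascal * unit_col q 0 = unit_col q 0"
proof (rule eq_matI)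
  fix i k assume "i < dim_row (unit_col q 0 :: 'k mat)" "k < dim_col (unit_col q 0 :: 'k mat)"
  then show "(pascal * unit_col q 0) $$ (i, k) = unit_col q 0 $$ (i, k)"
    using index_mult_unit_col[OF pascal_carrier, of i 0]
    by (auto simp: unit_col_def pascal_def binomial_eq_0)
qed (auto simp: unit_col_def pascal_def)

text \<open>
  On a vector whose last nonzero coordinate is the \<open>k\<close>-th, \<open>pascal - 1\<close> lowers this index by exactly
  one.
\<close>

lemma index_pascal_mult_top:
  assumes v: "v \<in> carrier_mat q 1" and k: "0 < k" "k < q"
    and top: "\<And>i. \<lbrakk>k < i; i < q\<rbrakk> \<Longrightarrow> v $$ (i, 0) = 0"
  shows "(pascal * v) $$ (k - 1, 0) = v $$ (k - 1, 0) + of_nat k * v $$ (k, 0)"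
    and "\<lbrakk>k \<le> i; i < q\<rbrakk> \<Longrightarrow> (pascal * v) $$ (i, 0) = v $$ (i, 0)"
proof -
  have "(pascal * v) $$ (k - 1, 0) = (\<Sum>j<q. pascal $$ (k - 1, j) * v $$ (j, 0))"
    using k by (intro index_mult_col[OF pascal_carrier v]) auto
  also have "\<dots> = (\<Sum>j\<in>{k - 1, k}. pascal $$ (k - 1, j) * v $$ (j, 0))"
  proof (intro sum.mono_neutral_right ballI)
    fix j assume j: "j \<in> {..<q} - {k - 1, k}"
    then consider "j < k - 1" | "k < j" by fastforce
    then show "pascal $$ (k - 1, j) * v $$ (j, 0) = 0"
      using j k top by cases (auto simp: pascal_def binomial_eq_0)
  qed (use k in auto)
  also have "\<dots> = v $$ (k - 1, 0) + of_nat k * v $$ (k, 0)"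
  proof -
    obtain l where "k = Suc l" using k(1) by (cases k) auto
    then show ?thesis using k by (simp add: pascal_def)
  qed
  finally show "(pascal * v) $$ (k - 1, 0) = v $$ (k - 1, 0) + of_nat k * v $$ (k, 0)" .
next
  assume i: "k \<le> i" "i < q"
  have "(pascal * v) $$ (i, 0) = (\<Sum>j<q. pascal $$ (i, j) * v $$ (j, 0))"
    using i by (intro index_mult_col[OF pascal_carrier v]) auto
  also have "\<dots> = (\<Sum>j\<in>{i}. pascal $$ (i, j) * v $$ (j, 0))"
  proof (intro sum.mono_neutral_right ballI)
    fix j assume j: "j \<in> {..<q} - {i}"
    then consider "j < i" | "i < j" by fastforce
    then show "pascal $$ (i, j) * v $$ (j, 0) = 0"
      using j i top by cases (auto simp: pascal_def binomial_eq_0)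
  qed (use i in auto)
  also have "\<dots> = v $$ (i, 0)" using i by (simp add: pascal_def)
  finally show "(pascal * v) $$ (i, 0) = v $$ (i, 0)" .
qed

lemma pascal_fixed_col:
  assumes v: "v \<in> carrier_mat q 1" and fixed: "pascal * v = v" and i: "0 < i" "i < q"
  shows "v $$ (i, 0) = 0"
proof (rule ccontr)
  assume "v $$ (i, 0) \<noteq> 0"
  define I where "I = {i. 0 < i \<and> i < q \<and> v $$ (i, 0) \<noteq> 0}"
  define k where "k = Max I"
  have fin: "finite I" unfolding I_def by simp
  have ne: "i \<in> I" using i \<open>v $$ (i, 0) \<noteq> 0\<close> by (simp add: I_def)
  have kI: "k \<in> I" unfolding k_def using fin ne by (intro Max_in) auto
  have "v $$ (j, 0) = 0" if "k < j" "j < q" for j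
  proof (rule ccontr)
    assume "v $$ (j, 0) \<noteq> 0"
    then have "j \<in> I" using that by (auto simp: I_def)
    then show False using Max_ge[OF fin] that unfolding k_def by (meson not_le)
  qed
  then have "(pascal * v) $$ (k - 1, 0) = v $$ (k - 1, 0) + of_nat k * v $$ (k, 0)"
    using kI v by (intro index_pascal_mult_top) (auto simp: I_def)
  then have "of_nat k * v $$ (k, 0) = 0" unfolding fixed by simp
  then show False using kI of_nat_neq_0[of k] by (auto simp: I_def)
qed

lemma pascal_pow_commute:
  "pascal [^]\<^bsub>SL q\<^esub> (m::nat) * artin_schreier =
    artin_schreier * pascal [^]\<^bsub>SL q\<^esub> m + of_nat m \<cdot>\<^sub>m pascal [^]\<^bsub>SL q\<^esub> m"
proof (induction m)
  case 0
  have "0 \<cdot>\<^sub>m 1\<^sub>m q = (0\<^sub>m q q :: 'k mat)" by (intro eq_matI) auto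
  then show ?case using artin_schreier_carrier by (simp add: one_SL)
next
  case (Suc m)
  define F where "F = pascal [^]\<^bsub>SL q\<^esub> m"
  have F: "F \<in> carrier_mat q q"
    unfolding F_def using sl.nat_pow_closed[OF pascal_SL] by (rule carrier_mat_if_SL)
  note car = F pascal_carrier artin_schreier_carrier
  have "pascal * artin_schreier = artin_schreier * pascal + pascal"
    unfolding pascal_artin_schreier artin_schreier_pow_q
    using car by (simp add: add_mult_distrib_mat[of _ q q _ _ q])
  then have "(F * pascal) * artin_schreier = F * (artin_schreier * pascal + pascal)"
    using car by (simp add: assoc_mult_mat[of _ q q _ q _ q])
  also have "\<dots> = (F * artin_schreier) * pascal + F * pascal"
    using car by (simp add: mult_add_distrib_mat[of _ q q _ q] assoc_mult_mat[of _ q q _ q _ q])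
  also have "F * artin_schreier = artin_schreier * F + of_nat m \<cdot>\<^sub>m F"
    using Suc by (simp add: F_def)
  also have "(artin_schreier * F + of_nat m \<cdot>\<^sub>m F) * pascal =
      artin_schreier * (F * pascal) + of_nat m \<cdot>\<^sub>m (F * pascal)"
    using car by (simp add: add_mult_distrib_mat[of _ q q _ _ q] assoc_mult_mat[of _ q q _ q _ q]
        mult_smult_assoc_mat[of _ q q _ q])
  also have "\<dots> + F * pascal = artin_schreier * (F * pascal) + (of_nat m \<cdot>\<^sub>m (F * pascal) + F * pascal)"
    using car by (intro assoc_add_mat[of _ q q]) auto
  also have "of_nat m \<cdot>\<^sub>m (F * pascal) + F * pascal = of_nat (Suc m) \<cdot>\<^sub>m (F * pascal)"
    using car by (intro eq_matI) (auto simp: algebra_simps)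
  finally show ?case by (simp add: F_def mult_SL)
qed

lemma pascal_pow_q: "pascal [^]\<^bsub>SL q\<^esub> q = \<one>\<^bsub>SL q\<^esub>"
proof (rule eq_if_commute_artin_schreier)
  have F: "pascal [^]\<^bsub>SL q\<^esub> q \<in> carrier_mat q q"
    using sl.nat_pow_closed[OF pascal_SL] by (rule carrier_mat_if_SL)
  have "0 \<cdot>\<^sub>m pascal [^]\<^bsub>SL q\<^esub> q = 0\<^sub>m q q" using F by (intro eq_matI) auto
  then show "pascal [^]\<^bsub>SL q\<^esub> q * artin_schreier = artin_schreier * pascal [^]\<^bsub>SL q\<^esub> q"
    using pascal_pow_commute[of q] F artin_schreier_carrier by (simp add: of_nat_q)
  show "pascal [^]\<^bsub>SL q\<^esub> q * unit_col q 0 = \<one>\<^bsub>SL q\<^esub> * unit_col q 0"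
    using cols.act_pow_fixed[OF pascal_SL unit_col_carrier pascal_unit_col_0]
    by (simp add: one_SL)
qed (use sl.nat_pow_closed[OF pascal_SL] artin_schreier_carrier in
    \<open>auto simp: one_SL intro: carrier_mat_if_SL\<close>)

text \<open>
  The norm of \<open>X\<close> is \<open>1\<close>. As \<open>X\<^sup>p\<close> is fixed by the automorphism, it is a scalar; its determinant
  shows that the scalar is \<open>1\<close>.
\<close>

lemma artin_schreier_pow_p:
  assumes p: "p * (q - 1) = q ^ q - 1"
  shows "artin_schreier [^]\<^bsub>SL q\<^esub> p = \<one>\<^bsub>SL q\<^esub>"
proof -
  let ?c = "artin_schreier" and ?f = "pascal"
  note cS = artin_schreier_SL and fS = pascal_SL
  have rel: "?f \<otimes>\<^bsub>SL q\<^esub> ?c = ?c [^]\<^bsub>SL q\<^esub> q \<otimes>\<^bsub>SL q\<^esub> ?f"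
    using pascal_artin_schreier by (simp add: mult_SL)
  have qq: "?c [^]\<^bsub>SL q\<^esub> (q ^ q) = ?c"
    using sl.pow_normalizes[OF cS fS rel, of q 1] cS by (simp add: pascal_pow_q)
  have "q ^ q = Suc (q ^ q - 1)" using q_ge_3 by simp
  then have "?c [^]\<^bsub>SL q\<^esub> (q ^ q - 1) \<otimes>\<^bsub>SL q\<^esub> ?c = ?c"
    using qq by (metis Group.nat_pow_Suc)
  then have one: "?c [^]\<^bsub>SL q\<^esub> (p * (q - 1)) = \<one>\<^bsub>SL q\<^esub>"
    using cS p sl.r_cancel_one' sl.nat_pow_closed by metis
  define P where "P = ?c [^]\<^bsub>SL q\<^esub> p"
  have PS: "P \<in> carrier (SL q)" using cS by (simp add: P_def)
  note P = carrier_mat_if_SL[OF PS]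
  have "p * q = p + p * (q - 1)" using q_ge_3 by (simp add: algebra_simps)
  then have "?c [^]\<^bsub>SL q\<^esub> (p * q) = P"
    using cS one by (simp add: sl.nat_pow_mult[symmetric] P_def)
  then have comm: "?f * P = P * ?f"
    using sl.pow_normalizes[OF cS fS rel, of 1 p] fS
    by (simp add: P_def mult_SL one_SL left_mult_one_mat[OF pascal_carrier])
  define v where "v = P * unit_col q 0"
  have v: "v \<in> carrier_mat q 1" using P by (simp add: v_def)
  have "?f * v = (?f * P) * unit_col q 0"
    using P pascal_carrier by (simp add: v_def assoc_mult_mat[of _ q q _ q _ 1])
  also have "\<dots> = v"
    unfolding comm using P pascal_carrier
    by (simp add: v_def assoc_mult_mat[of _ q q _ q _ 1] pascal_unit_col_0)
  finally have vi: "v $$ (i, 0) = 0" if "0 < i" "i < q" for i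
    using pascal_fixed_col[OF v] that by blast
  define l where "l = v $$ (0, 0)"
  have "P = l \<cdot>\<^sub>m 1\<^sub>m q"
  proof (rule eq_if_commute_artin_schreier)
    show "P * ?c = ?c * P" unfolding P_def by (rule artin_schreier_pow_commute)
    show "(l \<cdot>\<^sub>m 1\<^sub>m q) * ?c = ?c * (l \<cdot>\<^sub>m 1\<^sub>m q)"
      using artin_schreier_carrier
      by (simp add: mult_smult_assoc_mat[of _ q q _ q] mult_smult_distrib[of _ q q _ q])
    have "l \<cdot>\<^sub>m 1\<^sub>m q * unit_col q 0 = l \<cdot>\<^sub>m unit_col q 0"
      by (simp add: mult_smult_assoc_mat[of _ q q _ 1])
    also have "\<dots> = v"
    proof (rule eq_matI)
      fix i j assume "i < dim_row v" "j < dim_col v"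
      then show "(l \<cdot>\<^sub>m unit_col q 0) $$ (i, j) = v $$ (i, j)"
        using v vi by (cases "i = 0") (auto simp: unit_col_def l_def)
    qed (use v in \<open>auto simp: unit_col_def\<close>)
    finally show "P * unit_col q 0 = l \<cdot>\<^sub>m 1\<^sub>m q * unit_col q 0" by (simp add: v_def)
  qed (use P in auto)
  moreover have "Determinant.det P = 1" using PS by (simp add: carrier_SL_iff)
  ultimately have "l ^ q = 1" by (simp add: det_smult)
  then have "l = 1" by (simp add: power_q)
  with \<open>P = l \<cdot>\<^sub>m 1\<^sub>m q\<close> have "P = 1\<^sub>m q" by auto
  then show ?thesis by (simp add: P_def one_SL)
qed

end

section \<open>Groups containing many transvections\<close>

lemma nat_pow_SL_subgroup:
  "g [^]\<^bsub>SL n\<lparr>carrier := K\<rparr>\<^esub> (m::nat) = g [^]\<^bsub>SL n\<^esub> m"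
  by (rule monoid.nat_pow_consistent[OF group.is_monoid[OF group_SL], symmetric])

text \<open>
  The vectors \<open>v\<close> such that \<open>K\<close> contains every transvection \<open>1 + v r\<close> with center \<open>v\<close>, for the
  linear forms \<open>r\<close> with \<open>r v = 0\<close>. The zero vector is included.
\<close>

definition transvection_centers :: "nat \<Rightarrow> 'k::field mat set \<Rightarrow> 'k mat set" where
  "transvection_centers n K = {v \<in> carrier_mat n 1. \<forall>r\<in>carrier_mat 1 n.
     r * v = 0\<^sub>m 1 1 \<longrightarrow> 1\<^sub>m n + v * r \<in> K}"

lemma transvection_centersI:
  assumes "v \<in> carrier_mat n 1"
    and "\<And>r. \<lbrakk>r \<in> carrier_mat 1 n; r * v = 0\<^sub>m 1 1\<rbrakk> \<Longrightarrow> 1\<^sub>m n + v * r \<in> K"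
  shows "v \<in> transvection_centers n K"
  using assms by (simp add: transvection_centers_def)

lemma transvection_centersD:
  assumes "v \<in> transvection_centers n K"
  shows "v \<in> carrier_mat n 1"
    and "\<lbrakk>r \<in> carrier_mat 1 n; r * v = 0\<^sub>m 1 1\<rbrakk> \<Longrightarrow> 1\<^sub>m n + v * r \<in> K"
  using assms by (simp_all add: transvection_centers_def)

lemma transvection_centers_conj:
  fixes g :: "'k::field mat"
  assumes g: "g \<in> carrier (SL n)" and v: "v \<in> transvection_centers n K"
    and K: "K \<subseteq> carrier (SL n)"
    and conj: "\<And>k. k \<in> K \<Longrightarrow> g \<otimes>\<^bsub>SL n\<^esub> k \<otimes>\<^bsub>SL n\<^esub> inv\<^bsub>SL n\<^esub> g \<in> L"
  shows "g * v \<in> transvection_centers n L"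
proof (rule transvection_centersI)
  interpret group "SL n :: 'k mat monoid" by (rule group_SL)
  note gc = carrier_mat_if_SL[OF g] and vc = transvection_centersD(1)[OF v]
  show "g * v \<in> carrier_mat n 1" using gc vc by simp
  fix r :: "'k mat" assume r: "r \<in> carrier_mat 1 n" "r * (g * v) = 0\<^sub>m 1 1"
  have gvr: "g * v * r \<in> carrier_mat n n"
    by (rule mult_carrier_mat[OF mult_carrier_mat[OF gc vc] r(1)])
  have "r * g * v = 0\<^sub>m 1 1" using r gc vc by (simp add: assoc_mult_mat[of _ 1 n _ n _ 1])
  then have k: "1\<^sub>m n + v * (r * g) \<in> K"
    using mult_carrier_mat[OF r(1) gc] by (intro transvection_centersD(2)[OF v])
  have "g * (1\<^sub>m n + v * (r * g)) = g + g * (v * (r * g))"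
    using r gc vc by (simp add: mult_add_distrib_mat[of _ n n _ n])
  also have "g * (v * (r * g)) = (g * v * r) * g"
  proof -
    have "g * (v * (r * g)) = (g * v) * (r * g)"
      by (rule assoc_mult_mat[of _ n n _ 1 _ n, symmetric]) (use r gc vc in auto)
    also have "\<dots> = (g * v * r) * g"
      by (rule assoc_mult_mat[of _ n 1 _ n _ n, symmetric]) (use r gc vc in auto)
    finally show ?thesis .
  qed
  also have "g + (g * v * r) * g = (1\<^sub>m n + g * v * r) * g"
    using gc gvr by (simp add: add_mult_distrib_mat[of _ n n _ _ n])
  finally have eq: "g * (1\<^sub>m n + v * (r * g)) = (1\<^sub>m n + g * v * r) * g" .
  define t where "t = 1\<^sub>m n + g * v * r"
  define k' where "k' = 1\<^sub>m n + v * (r * g)"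
  have kS: "k' \<in> carrier (SL n)" using k K by (auto simp: k'_def)
  have tc: "t \<in> carrier_mat n n"
    unfolding t_def using gvr by (rule add_carrier_mat)
  have "Determinant.det (t * g) = Determinant.det (g * k')"
    using eq by (simp add: t_def k'_def)
  then have tS: "t \<in> carrier (SL n)"
    using tc gc g carrier_mat_if_SL[OF kS] kS by (simp add: det_mult carrier_SL_iff)
  have "t = g \<otimes>\<^bsub>SL n\<^esub> k' \<otimes>\<^bsub>SL n\<^esub> inv\<^bsub>SL n\<^esub> g"
  proof (subst inv_solve_right)
    show "g \<otimes>\<^bsub>SL n\<^esub> k' = t \<otimes>\<^bsub>SL n\<^esub> g" using eq by (simp add: mult_SL t_def k'_def)
  qed (use tS kS g in auto)
  then have "t \<in> L" using conj k by (simp add: k'_def)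
  then show "1\<^sub>m n + g * v * r \<in> L" by (simp add: t_def)
qed

lemma transvection_centers_smult:
  fixes v :: "'k::field mat"
  assumes v: "v \<in> transvection_centers n K"
  shows "a \<cdot>\<^sub>m v \<in> transvection_centers n K"
proof (rule transvection_centersI)
  note vc = transvection_centersD(1)[OF v]
  show "a \<cdot>\<^sub>m v \<in> carrier_mat n 1" using vc by simp
  fix r :: "'k mat" assume r: "r \<in> carrier_mat 1 n" "r * (a \<cdot>\<^sub>m v) = 0\<^sub>m 1 1"
  have "(a \<cdot>\<^sub>m r) * v = r * (a \<cdot>\<^sub>m v)"
    using r vc by (simp add: mult_smult_assoc_mat[of _ 1 n _ 1] mult_smult_distrib[of _ 1 n _ 1])
  then have "1\<^sub>m n + v * (a \<cdot>\<^sub>m r) \<in> K"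
    using r by (intro transvection_centersD(2)[OF v]) auto
  moreover have "v * (a \<cdot>\<^sub>m r) = a \<cdot>\<^sub>m v * r"
    using r vc by (simp add: mult_smult_assoc_mat[of _ n 1 _ n] mult_smult_distrib[of _ n 1 _ n])
  ultimately show "1\<^sub>m n + a \<cdot>\<^sub>m v * r \<in> K" by simp
qed

lemma transvection_centers_invariant:
  fixes g :: "'k::field mat"
  assumes K: "subgroup K (SL n)" and g: "g \<in> K" and v: "v \<in> transvection_centers n K"
  shows "g * v \<in> transvection_centers n K"
proof (rule transvection_centers_conj[OF _ v])
  show "g \<in> carrier (SL n)" using subgroup.mem_carrier[OF K g] .
  show "K \<subseteq> carrier (SL n)" using subgroup.subset[OF K] .
  fix k assume "k \<in> K"
  then show "g \<otimes>\<^bsub>SL n\<^esub> k \<otimes>\<^bsub>SL n\<^esub> inv\<^bsub>SL n\<^esub> g \<in> K"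
    using K g by (simp add: subgroup.m_closed subgroup.m_inv_closed)
qed

text \<open>
  The centers form a subspace: for independent centers \<open>v\<close>, \<open>w\<close> some transvection with center \<open>w\<close>
  maps \<open>v\<close> to \<open>v + w\<close>.
\<close>

lemma transvection_centers_add:
  fixes v :: "'k::field mat"
  assumes K: "subgroup K (SL n)"
    and v: "v \<in> transvection_centers n K" and w: "w \<in> transvection_centers n K"
  shows "v + w \<in> transvection_centers n K"
proof -
  note vc = transvection_centersD(1)[OF v] and wc = transvection_centersD(1)[OF w]
  show ?thesis
  proof (cases "\<exists>i<n. w $$ (i, 0) \<noteq> 0")
    case False
    then have "v + w = v" using vc wc by (intro eq_matI) auto
    then show ?thesis using v by simp
  next
    case True
    then obtain i where i: "i < n" "w $$ (i, 0) \<noteq> 0" by blast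
    define l where "l = v $$ (i, 0) / w $$ (i, 0)"
    show ?thesis
    proof (cases "\<exists>j<n. v $$ (j, 0) \<noteq> l * w $$ (j, 0)")
      case False
      then have "v + w = (l + 1) \<cdot>\<^sub>m w"
        using vc wc by (intro eq_matI) (auto simp: algebra_simps)
      then show ?thesis using transvection_centers_smult[OF w] by simp
    next
      case True
      then obtain j where j: "j < n" "v $$ (j, 0) \<noteq> l * w $$ (j, 0)" by blast
      have ij: "i \<noteq> j" using i j by (auto simp: l_def)
      define e where "e = v $$ (j, 0) - l * w $$ (j, 0)"
      define r :: "'k mat" where "r = mat 1 n (\<lambda>(_, k).
        if k = j then 1 / e else if k = i then - (w $$ (j, 0) / w $$ (i, 0)) / e else 0)"
      have e: "e \<noteq> 0" using j by (simp add: e_def)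
      have r: "r \<in> carrier_mat 1 n" by (simp add: r_def)
      have rx: "(r * x) $$ (0, 0) = (x $$ (j, 0) - w $$ (j, 0) / w $$ (i, 0) * x $$ (i, 0)) / e"
        if x: "x \<in> carrier_mat n 1" for x
      proof -
        have "(r * x) $$ (0, 0) = (\<Sum>k<n. r $$ (0, k) * x $$ (k, 0))"
          using x r by (simp add: scalar_prod_def lessThan_atLeast0)
        also have "\<dots> = (\<Sum>k\<in>{i, j}. r $$ (0, k) * x $$ (k, 0))"
          using i j by (intro sum.mono_neutral_right) (auto simp: r_def)
        also have "\<dots> = (x $$ (j, 0) - w $$ (j, 0) / w $$ (i, 0) * x $$ (i, 0)) / e"
          using i j ij e by (simp add: r_def field_simps)
        finally show ?thesis .
      qed
      have "(r * w) $$ (0, 0) = 0" using rx[OF wc] i by simp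
      then have "r * w = 0\<^sub>m 1 1" using r wc by (intro eq_matI) auto
      then have t: "1\<^sub>m n + w * r \<in> K" using r by (intro transvection_centersD(2)[OF w])
      have "(r * v) $$ (0, 0) = 1"
        using rx[OF vc] e i by (simp add: e_def l_def mult.commute)
      then have rv: "r * v = 1\<^sub>m 1" using r vc by (intro eq_matI) auto
      have "(1\<^sub>m n + w * r) * v = v + w * r * v"
        using r vc wc by (simp add: add_mult_distrib_mat[of _ n n _ _ 1] mult_carrier_mat[of _ n 1])
      also have "w * r * v = w * (r * v)"
        by (rule assoc_mult_mat[of _ n 1 _ n _ 1]) (use r vc wc in auto)
      also have "\<dots> = w" unfolding rv using wc by simp
      finally have "(1\<^sub>m n + w * r) * v = v + w" .
      then show ?thesis using transvection_centers_invariant[OF K t v] by simp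
    qed
  qed
qed

text \<open>
  The elementary transvection at \<open>(i, j)\<close> has the \<open>i\<close>-th unit vector as its center.
\<close>

lemma addrow_mat_if_unit_col_center:
  fixes K :: "'k::field mat set"
  assumes "unit_col n i \<in> transvection_centers n K" "i < n" "j < n" "i \<noteq> j"
  shows "addrow_mat n t i j \<in> K"
proof -
  define r :: "'k mat" where "r = mat 1 n (\<lambda>(_, k). if k = j then t else 0)"
  have r: "r \<in> carrier_mat 1 n" by (simp add: r_def)
  have "r * unit_col n i = 0\<^sub>m 1 1"
    using assms(2-4) by (intro eq_matI)
      (auto simp: r_def unit_col_def scalar_prod_def intro!: sum.neutral)
  then have "1\<^sub>m n + unit_col n i * r \<in> K"
    using r by (intro transvection_centersD(2)[OF assms(1)])
  moreover have "1\<^sub>m n + unit_col n i * r = addrow_mat n t i j"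
    using assms(2-4) by (intro eq_matI) (auto simp: r_def unit_col_def scalar_prod_def)
  ultimately show ?thesis by simp
qed

lemma echelon_span:
  fixes W :: "'k::field mat set"
  assumes add: "\<And>v w. \<lbrakk>v \<in> W; w \<in> W\<rbrakk> \<Longrightarrow> v + w \<in> W"
    and smult: "\<And>a v. v \<in> W \<Longrightarrow> a \<cdot>\<^sub>m v \<in> W" and W: "W \<subseteq> carrier_mat n 1"
    and ech: "\<And>k. k < d \<Longrightarrow> \<exists>w\<in>W. w $$ (k, 0) \<noteq> 0 \<and> (\<forall>i<n. k < i \<longrightarrow> w $$ (i, 0) = 0)"
    and d: "0 < d" "d \<le> n"
    and v: "v \<in> carrier_mat n 1" "\<And>i. \<lbrakk>i < n; d \<le> i\<rbrakk> \<Longrightarrow> v $$ (i, 0) = 0"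
  shows "v \<in> W"
proof -
  have "v \<in> W" if "k \<le> d" "v \<in> carrier_mat n 1" "\<And>i. \<lbrakk>i < n; k \<le> i\<rbrakk> \<Longrightarrow> v $$ (i, 0) = 0" for k v
    using that
  proof (induction k arbitrary: v)
    case 0
    obtain w where w: "w \<in> W" using ech[OF d(1)] by blast
    have "v = 0 \<cdot>\<^sub>m w" using 0 w W by (intro eq_matI) auto
    then show ?case using smult[OF w] by simp
  next
    case (Suc k)
    obtain w where w: "w \<in> W" "w $$ (k, 0) \<noteq> 0" "\<forall>i<n. k < i \<longrightarrow> w $$ (i, 0) = 0"
      using ech[of k] Suc.prems by auto
    have wc: "w \<in> carrier_mat n 1" using w W by blast
    let ?a = "v $$ (k, 0) / w $$ (k, 0)"
    have vc: "v + (- ?a) \<cdot>\<^sub>m w \<in> carrier_mat n 1" using Suc.prems wc by simp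
    have "v + (- ?a) \<cdot>\<^sub>m w \<in> W"
    proof (rule Suc.IH[OF _ vc])
      fix i assume "i < n" "k \<le> i"
      then show "(v + (- ?a) \<cdot>\<^sub>m w) $$ (i, 0) = 0"
        using Suc.prems(2,3) wc w by (cases "i = k") auto
    qed (use Suc.prems in simp)
    then have "v + (- ?a) \<cdot>\<^sub>m w + ?a \<cdot>\<^sub>m w \<in> W" using smult[OF w(1)] add by blast
    moreover have "v + (- ?a) \<cdot>\<^sub>m w + ?a \<cdot>\<^sub>m w = v"
      using Suc.prems(2) wc by (intro eq_matI) auto
    ultimately show ?case by simp
  qed
  from this[of d v] v show ?thesis by simp
qed

context odd_prime_field
begin

text \<open>A single unipotent Jordan block leaves invariant only the members of its flag.\<close>

lemma pascal_invariant_subspace: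
  assumes add: "\<And>v w. \<lbrakk>v \<in> W; w \<in> W\<rbrakk> \<Longrightarrow> v + w \<in> W"
    and smult: "\<And>a v. v \<in> W \<Longrightarrow> a \<cdot>\<^sub>m v \<in> W" and W: "W \<subseteq> carrier_mat q 1"
    and inv: "\<And>v. v \<in> W \<Longrightarrow> pascal * v \<in> W"
    and ne: "u \<in> W" "i < q" "u $$ (i, 0) \<noteq> 0"
  obtains d where "0 < d" "d \<le> q"
    "W = {v \<in> carrier_mat q 1. \<forall>i<q. d \<le> i \<longrightarrow> v $$ (i, 0) = 0}"
proof -
  define I where "I = {i. i < q \<and> (\<exists>v\<in>W. v $$ (i, 0) \<noteq> 0)}"
  have fin: "finite I" by (simp add: I_def)
  have iI: "i \<in> I" using ne by (auto simp: I_def)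
  define m where "m = Max I"
  have mI: "m \<in> I" unfolding m_def using fin iI by (intro Max_in) auto
  then obtain u where u: "u \<in> W" "u $$ (m, 0) \<noteq> 0" and mq: "m < q" by (auto simp: I_def)
  have top: "v $$ (i, 0) = 0" if "v \<in> W" "m < i" "i < q" for v i
  proof (rule ccontr)
    assume "v $$ (i, 0) \<noteq> 0"
    then have "i \<in> I" using that by (auto simp: I_def)
    then show False using Max_ge[OF fin] that unfolding m_def by (meson not_le)
  qed
  have down: "\<exists>w\<in>W. w $$ (m - k, 0) \<noteq> 0 \<and> (\<forall>i<q. m - k < i \<longrightarrow> w $$ (i, 0) = 0)"
    if "k \<le> m" for k
    using that
  proof (induction k)
    case 0 then show ?case using u top by auto
  next
    case (Suc k)
    then obtain w where w: "w \<in> W" "w $$ (m - k, 0) \<noteq> 0" "\<forall>i<q. m - k < i \<longrightarrow> w $$ (i, 0) = 0"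
      by auto
    have wc: "w \<in> carrier_mat q 1" using w W by blast
    have k: "0 < m - k" "m - k < q" using Suc.prems mq by auto
    let ?w = "pascal * w + (- 1) \<cdot>\<^sub>m w"
    have "?w \<in> W" using add inv smult w(1) by blast
    moreover have e: "?w $$ (i, 0) = (pascal * w) $$ (i, 0) - w $$ (i, 0)" if "i < q" for i
      using that wc pascal_carrier by (simp del: index_mult_mat(1))
    have "?w $$ (m - Suc k, 0) = of_nat (m - k) * w $$ (m - k, 0)"
      using e[of "m - Suc k"] index_pascal_mult_top(1)[OF wc k] w(3) mq by simp
    then have "?w $$ (m - Suc k, 0) \<noteq> 0" using w(2) of_nat_neq_0[OF k] by simp
    moreover have "?w $$ (i, 0) = 0" if "i < q" "m - Suc k < i" for i
      using e[of i] index_pascal_mult_top(2)[OF wc k _ _ that(1)] w(3) that by simp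
    ultimately show ?case by blast
  qed
  have "v \<in> W" if "v \<in> carrier_mat q 1" "\<And>i. \<lbrakk>i < q; Suc m \<le> i\<rbrakk> \<Longrightarrow> v $$ (i, 0) = 0" for v
  proof (rule echelon_span[OF add smult W _ _ _ that])
    fix k assume "k < Suc m"
    then show "\<exists>w\<in>W. w $$ (k, 0) \<noteq> 0 \<and> (\<forall>i<q. k < i \<longrightarrow> w $$ (i, 0) = 0)"
      using down[of "m - k"] by simp
  qed (use mq in auto)
  then have "W = {v \<in> carrier_mat q 1. \<forall>i<q. Suc m \<le> i \<longrightarrow> v $$ (i, 0) = 0}"
    using W top by (auto simp: Suc_le_eq)
  then show ?thesis using that[of "Suc m"] mq by simp
qed

lemma addrow_mat_pow_q:
  assumes "k \<noteq> l" "l < q"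
  shows "addrow_mat q (a :: 'k) k l [^]\<^bsub>SL q\<^esub> q = \<one>\<^bsub>SL q\<^esub>"
  using addrow_mat_pow[OF assms, of a q] assms by (simp add: of_nat_q addrow_mat_zero one_SL)

lemma diagonal_pow:
  assumes h: "h \<in> carrier (SL q)" "diagonal_mat h"
  shows "h [^]\<^bsub>SL q\<^esub> (q - 1) = (\<one>\<^bsub>SL q\<^esub> :: 'k mat)"
proof -
  note hc = carrier_mat_if_SL[OF h(1)]
  have off: "h $$ (i, j) = 0" if "i < q" "j < q" "i \<noteq> j" for i j
    using h(2) hc that by (auto simp: diagonal_mat_def)
  have pow: "h [^]\<^bsub>SL q\<^esub> (m::nat) = mat q q (\<lambda>(i, j). if i = j then (h $$ (i, i)) ^ m else 0)" for m
  proof (induction m)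
    case 0 then show ?case by (auto simp: one_SL intro!: eq_matI)
  next
    case (Suc m)
    show ?case
    proof (rule eq_matI)
      fix i j assume "i < dim_row (mat q q (\<lambda>(i, j). if i = j then (h $$ (i, i)) ^ Suc m else 0))"
        "j < dim_col (mat q q (\<lambda>(i, j). if i = j then (h $$ (i, i)) ^ Suc m else 0))"
      then have ij: "i < q" "j < q" by auto
      have "(h [^]\<^bsub>SL q\<^esub> Suc m) $$ (i, j) =
          (\<Sum>k<q. (if i = k then (h $$ (i, i)) ^ m else 0) * h $$ (k, j))"
        using ij hc by (simp add: Suc mult_SL scalar_prod_def lessThan_atLeast0)
      also have "\<dots> = (\<Sum>k<q. if i = k then (h $$ (i, i)) ^ m * h $$ (k, j) else 0)"
        by (intro sum.cong) auto
      also have "\<dots> = (h $$ (i, i)) ^ m * h $$ (i, j)" using ij by simp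
      also have "\<dots> = (if i = j then (h $$ (i, i)) ^ Suc m else 0)"
        using off[of i j] ij by auto
      finally show "(h [^]\<^bsub>SL q\<^esub> Suc m) $$ (i, j) =
          mat q q (\<lambda>(i, j). if i = j then (h $$ (i, i)) ^ Suc m else 0) $$ (i, j)" using ij by simp
    qed (use hc in \<open>auto simp: Suc mult_SL\<close>)
  qed
  have nz: "h $$ (i, i) \<noteq> 0" if "i < q" for i
  proof
    assume "h $$ (i, i) = 0"
    then have "0 \<in> set (diag_mat h)" using hc that by (force simp: diag_mat_def)
    moreover have "upper_triangular h" using off hc by auto
    ultimately have "Determinant.det h = 0"
      using det_upper_triangular[OF _ hc] by (simp add: prod_list_zero_iff)
    then show False using h(1) by (simp add: carrier_SL_iff)
  qed
  have "(h $$ (i, i)) ^ (q - 1) = 1" if "i < q" for i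
  proof -
    have "(h $$ (i, i)) ^ (q - 1) * h $$ (i, i) = (h $$ (i, i)) ^ q"
      using q_ge_3 by (simp flip: power_Suc2)
    then show ?thesis using nz[OF that] by (simp add: power_q)
  qed
  then show ?thesis unfolding pow by (auto simp: one_SL intro!: eq_matI)
qed

text \<open>
  Elimination writes the elements of \<open>K\<close> as products of transvections, which act trivially, and a
  diagonal matrix. So \<open>K\<close> acts with exponent dividing \<open>q - 1\<close>, which is not divisible by \<open>r\<close>.
\<close>

lemma transvections_act_nontrivially:
  assumes K: "subgroup K (SL q :: 'k mat monoid)"
    and act: "set_action (SL q\<lparr>carrier := K\<rparr>) X act"
    and X: "card X = r" "prime r" "\<not> r dvd q - 1"
    and trans: "\<And>x y. \<lbrakk>x \<in> X; y \<in> X\<rbrakk> \<Longrightarrow> \<exists>g\<in>K. act g x = y"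
    and bu: "\<And>g. g \<in> K \<Longrightarrow> block_upper d g"
    and KE: "\<And>i j t. \<lbrakk>i < q; j < q; i \<noteq> j; i < d \<or> d \<le> j\<rbrakk> \<Longrightarrow> addrow_mat q t i j \<in> K"
    and triv: "\<And>i j t x. \<lbrakk>i < q; j < q; i \<noteq> j; i < d \<or> d \<le> j; x \<in> X\<rbrakk>
      \<Longrightarrow> act (addrow_mat q t i j) x = x"
  shows False
proof -
  interpret K: set_action "SL q\<lparr>carrier := K\<rparr>" X act by (rule act)
  define S where "S = {g \<in> K. \<forall>x\<in>X. act g x = x}"
  have S: "subgroup S (SL q)" unfolding S_def by (rule sl.subgroup_acting_trivially[OF K act])
  have pow: "act (g [^]\<^bsub>SL q\<lparr>carrier := K\<rparr>\<^esub> (q - 1)) x = x" if g: "g \<in> K" and x: "x \<in> X" for g x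
  proof -
    obtain B where B: "B \<in> S" "diagonal_mat (B * g)"
      using block_upper_diagonalize[OF _ bu S, of g] subgroup.mem_carrier[OF K g] g KE triv
      by (auto simp: S_def)
    let ?h = "B * g"
    have BK: "B \<in> K" using B by (simp add: S_def)
    then have hK: "?h \<in> K" using subgroup_SL_mult[OF K] g by blast
    have eq: "act ?h y = act g y" if y: "y \<in> X" for y
      using K.act_mult[of B g y] BK g y B(1) K.act_closed[of g y] by (simp add: S_def mult_SL)
    have "(act g ^^ m) x = (act ?h ^^ m) x \<and> (act g ^^ m) x \<in> X" for m
      by (induction m) (use x eq g K.act_closed in auto)
    then have "(act g ^^ (q - 1)) x = (act ?h ^^ (q - 1)) x" by blast
    moreover have "?h [^]\<^bsub>SL q\<lparr>carrier := K\<rparr>\<^esub> (q - 1) = \<one>\<^bsub>SL q\<^esub>"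
      using diagonal_pow[OF subgroup.mem_carrier[OF K hK] B(2)]
      by (simp add: nat_pow_SL_subgroup)
    ultimately show ?thesis
      using K.act_pow[of g x "q - 1"] K.act_pow[of ?h x "q - 1"] g hK x K.act_one[OF x] by simp
  qed
  have "finite K" using subgroup.subset[OF K] finite_carrier_SL by (rule finite_subset)
  then show False
    using K.prime_degree_exponent[OF _ X(1,2) _ X(3)] trans pow by simp
qed

text \<open>
  The transvection at \<open>(i, j)\<close> is a central commutator of transvections at \<open>(i, k)\<close> and \<open>(k, j)\<close>, and
  \<open>q\<close> points are too few for a nonabelian \<open>q\<close>-group.
\<close>

lemma elementary_act_trivially:
  assumes K: "subgroup K (SL q :: 'k mat monoid)"
    and act: "set_action (SL q\<lparr>carrier := K\<rparr>) X act" and X: "card X = q"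
    and ijk: "i < q" "j < q" "k < q" "i \<noteq> j" "i \<noteq> k" "j \<noteq> k"
    and KE: "\<And>t. addrow_mat q t i j \<in> K" "\<And>t. addrow_mat q t i k \<in> K" "\<And>t. addrow_mat q t k j \<in> K"
    and x: "x \<in> X"
  shows "act (addrow_mat q t i j) x = x"
proof -
  interpret K: set_action "SL q\<lparr>carrier := K\<rparr>" X act by (rule act)
  note c = addrow_mat_commutator[OF ijk, of 1 t, unfolded mult_1_left]
  show ?thesis
  proof (rule K.central_commutator_trivial[of "addrow_mat q 1 i k" "addrow_mat q t k j"])
    fix u assume "u \<in> X"
    then show "act (addrow_mat q t i j [^]\<^bsub>SL q\<lparr>carrier := K\<rparr>\<^esub> q) u = u"
      using addrow_mat_pow_q[of i j t] ijk K.act_one by (simp add: nat_pow_SL_subgroup)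
  qed (use c KE X prime_q x in \<open>auto simp: mult_SL\<close>)
qed

text \<open>
  The group of all transvections whose center is the first unit vector, together with the identity.
\<close>

definition elations :: "'k mat set" where
  "elations = (\<lambda>r. 1\<^sub>m q + unit_col q 0 * r) ` {r \<in> carrier_mat 1 q. r $$ (0, 0) = 0}"

lemma index_elation:
  assumes "r \<in> carrier_mat 1 q" "i < q" "j < q"
  shows "(1\<^sub>m q + unit_col q 0 * r) $$ (i, j) =
    (if i = j then 1 else 0) + (if i = 0 then r $$ (0, j) else (0 :: 'k))"
  using assms by (simp add: scalar_prod_def unit_col_def)

lemma elation_SL:
  assumes r: "r \<in> carrier_mat 1 q" "r $$ (0, 0) = 0"
  shows "1\<^sub>m q + unit_col q 0 * r \<in> carrier (SL q :: 'k mat monoid)"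
proof -
  let ?A = "1\<^sub>m q + unit_col q 0 * r"
  have A: "?A \<in> carrier_mat q q"
    using r by (intro add_carrier_mat mult_carrier_mat[of _ q 1]) auto
  have "upper_triangular ?A"
  proof (rule upper_triangularI)
    fix i j assume "j < i" "i < dim_row ?A"
    then show "?A $$ (i, j) = 0" using A index_elation[OF r(1), of i j] by auto
  qed
  then have "Determinant.det ?A = prod_list (diag_mat ?A)" using A by (rule det_upper_triangular)
  also have "diag_mat ?A = map (\<lambda>_. 1) [0..<q]"
    unfolding diag_mat_def using A index_elation[OF r(1)] r(2) by (auto simp: r)
  also have "prod_list \<dots> = (1 :: 'k)" by (induction q) auto
  finally show ?thesis using A by (simp add: carrier_SL_iff)
qed

lemma elation_mult:
  assumes r: "r \<in> carrier_mat 1 q" "r $$ (0, 0) = 0" and s: "s \<in> carrier_mat 1 q"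
  shows "(1\<^sub>m q + unit_col q 0 * r) * (1\<^sub>m q + unit_col q 0 * s) =
    (1\<^sub>m q + unit_col q 0 * (r + s) :: 'k mat)"
proof -
  let ?u = "unit_col q 0 :: 'k mat"
  have u: "?u * r \<in> carrier_mat q q" "?u * s \<in> carrier_mat q q"
    using r s by (auto intro!: mult_carrier_mat[of _ q 1])
  have "r * ?u = 0\<^sub>m 1 1"
    using r q_ge_3 by (intro eq_matI)
      (auto simp: scalar_prod_def unit_col_def if_distrib cong: if_cong)
  moreover have "?u * r * (?u * s) = ?u * ((r * ?u) * s)"
  proof -
    have "?u * r * (?u * s) = ?u * (r * (?u * s))"
      by (rule assoc_mult_mat[of _ q 1 _ q _ q]) (use r u in auto)
    also have "r * (?u * s) = r * ?u * s"
      by (rule assoc_mult_mat[of _ 1 q _ 1 _ q, symmetric]) (use r s in auto)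
    finally show ?thesis .
  qed
  ultimately have z: "?u * r * (?u * s) = 0\<^sub>m q q"
    using s by (simp add: right_mult_zero_mat[OF unit_col_carrier_Suc])
  have "(1\<^sub>m q + ?u * r) * (1\<^sub>m q + ?u * s) = (1\<^sub>m q + ?u * r) + (?u * s + ?u * r * (?u * s))"
    using u by (simp add: add_mult_distrib_mat[of _ q q _ _ q] mult_add_distrib_mat[of _ q q _ q]
        left_mult_one_mat[OF u(2)] right_mult_one_mat[OF u(1)])
  also have "\<dots> = 1\<^sub>m q + ?u * (r + s)"
    unfolding z using u r s
    by (simp add: mult_add_distrib_mat[of _ q 1 _ q] assoc_add_mat[of _ q q] right_add_zero_mat[OF u(2)])
  finally show ?thesis .
qed

lemma subgroup_elations: "subgroup elations (SL q)"
proof (rule sl.subgroupI)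
  show "elations \<subseteq> carrier (SL q)" using elation_SL by (auto simp: elations_def)
  show "elations \<noteq> {}" using q_ge_3 by (auto simp: elations_def intro!: exI[of _ "0\<^sub>m 1 q"])
next
  fix a b assume "a \<in> elations" "b \<in> elations"
  then obtain r s where rs: "r \<in> carrier_mat 1 q" "r $$ (0, 0) = 0" "s \<in> carrier_mat 1 q"
    "s $$ (0, 0) = 0" "a = 1\<^sub>m q + unit_col q 0 * r" "b = 1\<^sub>m q + unit_col q 0 * s"
    by (auto simp: elations_def)
  then have "a \<otimes>\<^bsub>SL q\<^esub> b = 1\<^sub>m q + unit_col q 0 * (r + s)"
    by (simp add: mult_SL elation_mult)
  moreover have "r + s \<in> {r \<in> carrier_mat 1 q. r $$ (0, 0) = 0}" using rs q_ge_3 by auto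
  ultimately show "a \<otimes>\<^bsub>SL q\<^esub> b \<in> elations" unfolding elations_def by blast
next
  fix a assume "a \<in> elations"
  then obtain r where r: "r \<in> carrier_mat 1 q" "r $$ (0, 0) = 0"
    and a: "a = 1\<^sub>m q + unit_col q 0 * r" by (auto simp: elations_def)
  let ?b = "1\<^sub>m q + unit_col q 0 * (- r) :: 'k mat"
  have mr: "- r \<in> carrier_mat 1 q" "(- r) $$ (0, 0) = 0" using r q_ge_3 by auto
  have "- r + r = 0\<^sub>m 1 q" using r by (intro eq_matI) auto
  then have "?b * a = 1\<^sub>m q + unit_col q 0 * 0\<^sub>m 1 q"
    unfolding a using elation_mult[OF mr r(1)] by simp
  then have "?b * a = 1\<^sub>m q" by (simp add: right_mult_zero_mat[OF unit_col_carrier_Suc])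
  then have "inv\<^bsub>SL q\<^esub> a = ?b"
    using elation_SL[OF r] elation_SL[OF mr] a
    by (intro sl.inv_equality) (auto simp: mult_SL one_SL)
  then show "inv\<^bsub>SL q\<^esub> a \<in> elations" using mr by (auto simp: elations_def)
qed

lemma card_elations: "card elations = q ^ (q - 1)"
proof -
  let ?T = "{r \<in> carrier_mat 1 q. r $$ (0, 0) = (0 :: 'k)}"
  have "inj_on (\<lambda>r. 1\<^sub>m q + unit_col q 0 * r :: 'k mat) ?T"
  proof (rule inj_onI)
    fix r s :: "'k mat" assume rs: "r \<in> ?T" "s \<in> ?T"
      and eq: "1\<^sub>m q + unit_col q 0 * r = 1\<^sub>m q + unit_col q 0 * s"
    show "r = s"
    proof (rule eq_matI)
      fix i j assume "i < dim_row s" "j < dim_col s"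
      then have ij: "i = 0" "j < q" using rs by auto
      then have "(1\<^sub>m q + unit_col q 0 * r) $$ (0, j) = (1\<^sub>m q + unit_col q 0 * s) $$ (0, j)"
        using eq by simp
      then show "r $$ (i, j) = s $$ (i, j)"
        using index_elation[of r 0 j] index_elation[of s 0 j] rs ij q_ge_3 by simp
    qed (use rs in auto)
  qed
  then have "card elations = card ?T" unfolding elations_def by (rule card_image)
  also have "bij_betw (\<lambda>g. mat 1 q (\<lambda>(_, j). if j = 0 then 0 else g j)) ({1..<q} \<rightarrow>\<^sub>E UNIV) ?T"
  proof (rule bij_betw_byWitness[where f' = "\<lambda>r. restrict (\<lambda>j. r $$ (0, j)) {1..<q}"])
    show "\<forall>g\<in>{1..<q} \<rightarrow>\<^sub>E (UNIV :: 'k set).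
        restrict (\<lambda>j. mat 1 q (\<lambda>(_, j). if j = 0 then 0 else g j) $$ (0, j)) {1..<q} = g"
      by (auto simp: PiE_def extensional_def fun_eq_iff restrict_def)
    show "\<forall>r\<in>?T. mat 1 q (\<lambda>(_, j). if j = 0 then 0 else
        restrict (\<lambda>j. r $$ (0, j)) {1..<q} j) = r"
      by (auto intro!: eq_matI)
  qed (use q_ge_3 in auto)
  then have "card ?T = card ({1..<q} \<rightarrow>\<^sub>E (UNIV :: 'k set))" by (simp add: bij_betw_same_card)
  also have "\<dots> = q ^ (q - 1)" by (simp add: card_PiE card_k)
  finally show ?thesis .
qed

lemma unit_col_0_center_iff:
  "unit_col q 0 \<in> transvection_centers q K \<longleftrightarrow> elations \<subseteq> (K :: 'k mat set)"
proof -
  have "(r * unit_col q 0 = 0\<^sub>m 1 1) = (r $$ (0, 0) = 0)" if r: "r \<in> carrier_mat 1 q" for r :: "'k mat"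
  proof -
    have "(r * unit_col q 0) $$ (0, 0) = r $$ (0, 0)"
      using r q_ge_3 by (simp add: scalar_prod_def unit_col_def if_distrib cong: if_cong)
    moreover have "(r * unit_col q 0 = 0\<^sub>m 1 1) = ((r * unit_col q 0) $$ (0, 0) = 0)"
    proof
      assume "(r * unit_col q 0) $$ (0, 0) = 0"
      then show "r * unit_col q 0 = 0\<^sub>m 1 1" using r by (intro eq_matI) (auto simp: unit_col_def)
    qed auto
    ultimately show ?thesis by simp
  qed
  then show ?thesis by (auto simp: transvection_centers_def elations_def)
qed

end

section \<open>Imprimitive actions of degree pq\<close>

lemma prime_mult_cases:
  fixes a b p q :: nat
  assumes "prime p" "prime q" "a * b = p * q" "1 < b" "b < p * q"
  shows "(a = p \<and> b = q) \<or> (a = q \<and> b = p)"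
proof -
  have p0: "p > 0" and q0: "q > 0" using assms prime_gt_0_nat by auto
  have "p dvd a * b" using assms(3) by simp
  then consider "p dvd a" | "p dvd b" using assms(1) prime_dvd_mult_iff by blast
  then show ?thesis
  proof cases
    case 1
    then obtain a' where a': "a = p * a'" by (auto simp: dvd_def)
    then have "a' * b = q" using assms(3) p0 by simp
    then have "b dvd q" by (metis dvd_triv_right)
    then have "b = q" using assms(2,4) by (metis nat_neq_iff prime_nat_iff)
    then show ?thesis using \<open>a' * b = q\<close> a' q0 by simp
  next
    case 2
    then obtain b' where b': "b = p * b'" by (auto simp: dvd_def)
    then have e: "a * b' = q" using assms(3) p0 by (simp add: mult.left_commute)
    then have "b' dvd q" by (metis dvd_triv_right)
    then have "b' = 1 \<or> b' = q" using assms(2) by (metis prime_nat_iff)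
    moreover have "b' \<noteq> q" using assms(5) b' by auto
    ultimately show ?thesis using e b' by simp
  qed
qed

text \<open>
  A transitive action of \<open>SL\<^sub>q(q)\<close> on \<open>p * q\<close> points with a nontrivial block \<open>S\<close>.
\<close>

locale sl_imprimitive = odd_prime_field q ty + om: set_action "SL q :: 'k mat monoid" \<Omega> act
  for q :: nat and ty :: "'k::{field,finite} itself" and \<Omega> :: "'x set" and act +
  fixes p :: nat and S :: "'x set"
  assumes prime_p: "prime p" and p_eq: "p * (q - 1) = q ^ q - 1" and card_Omega: "card \<Omega> = p * q"
    and trans: "\<And>x y. \<lbrakk>x \<in> \<Omega>; y \<in> \<Omega>\<rbrakk> \<Longrightarrow> \<exists>g\<in>carrier (SL q). act g x = y"
    and S_sub: "S \<subseteq> \<Omega>" and card_S: "1 < card S" "card S < card \<Omega>"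
    and block: "\<And>g. g \<in> carrier (SL q) \<Longrightarrow> act g ` S = S \<or> act g ` S \<inter> S = {}"
begin

lemma p_gt: "q ^ (q - 1) < p"
proof -
  have "q ^ (q - 1) * (q - 1) = q ^ (q - 1) * q - q ^ (q - 1)" by (simp add: diff_mult_distrib2)
  also have "q ^ (q - 1) * q = q ^ q" using q_ge_3 by (simp flip: power_Suc2)
  finally have "q ^ (q - 1) * (q - 1) = q ^ q - q ^ (q - 1)" .
  moreover have "1 < q ^ (q - 1)" using q_ge_3 by (intro one_less_power) auto
  moreover have "q ^ (q - 1) \<le> q ^ q" using q_ge_3 by (intro power_increasing) auto
  ultimately have "q ^ (q - 1) * (q - 1) < p * (q - 1)" using p_eq by linarith
  then show ?thesis by simp
qed

lemma q_less_p: "q < p"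
proof -
  have "q ^ 1 \<le> q ^ (q - 1)" using q_ge_3 by (intro power_increasing) auto
  then show ?thesis using p_gt by simp
qed

lemma not_q_dvd_p: "\<not> q dvd p"
  using prime_p prime_q q_less_p by (metis less_irrefl primes_dvd_imp_eq)

lemma not_dvd_q_minus_1: "\<not> q dvd q - 1" "\<not> p dvd q - 1"
  using q_ge_3 q_less_p by (auto dest: dvd_imp_le)

lemma finite_Omega: "finite \<Omega>"
  using card_Omega prime_p prime_q prime_gt_0_nat by (metis card_gt_0_iff nat_0_less_mult_iff)

text \<open>
  The block system generated by \<open>S\<close>.
\<close>

definition blocks :: "'x set set" where
  "blocks = (\<lambda>g. act g ` S) ` carrier (SL q)"

lemma image_mult:
  assumes "g \<in> carrier (SL q)" "h \<in> carrier (SL q)" "D \<subseteq> \<Omega>"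
  shows "act (g \<otimes>\<^bsub>SL q\<^esub> h) ` D = act g ` (act h ` D)"
  using assms om.act_mult by (force simp: image_image intro!: image_cong)

lemma image_one: "D \<subseteq> \<Omega> \<Longrightarrow> act \<one>\<^bsub>SL q\<^esub> ` D = D"
  using om.act_one by (force simp: image_iff)

lemma blocks_sub: "D \<in> blocks \<Longrightarrow> D \<subseteq> \<Omega>"
  using S_sub om.act_closed by (auto simp: blocks_def)

lemma S_block: "S \<in> blocks"
  unfolding blocks_def using image_one[OF S_sub] sl.one_closed by blast

lemma image_block: "\<lbrakk>g \<in> carrier (SL q); D \<in> blocks\<rbrakk> \<Longrightarrow> act g ` D \<in> blocks"
proof -
  assume g: "g \<in> carrier (SL q)" and "D \<in> blocks"
  then obtain h where h: "h \<in> carrier (SL q)" "D = act h ` S" by (auto simp: blocks_def)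
  then have "act g ` D = act (g \<otimes>\<^bsub>SL q\<^esub> h) ` S" using image_mult[OF g h(1) S_sub] by simp
  then show "act g ` D \<in> blocks" using g h unfolding blocks_def by blast
qed

lemma inj_on_act: "g \<in> carrier (SL q) \<Longrightarrow> inj_on (act g) \<Omega>"
  using om.act_bij by (simp add: bij_betw_def)

sublocale bl: set_action "SL q :: 'k mat monoid" blocks "\<lambda>g D. act g ` D"
  using image_block image_one image_mult blocks_sub by unfold_locales auto

lemma blocks_trans:
  assumes "D \<in> blocks" "E \<in> blocks"
  shows "\<exists>g\<in>carrier (SL q). act g ` D = E"
proof -
  obtain g h where gh: "g \<in> carrier (SL q)" "D = act g ` S" "h \<in> carrier (SL q)" "E = act h ` S"
    using assms by (auto simp: blocks_def)
  then have "act (h \<otimes>\<^bsub>SL q\<^esub> inv\<^bsub>SL q\<^esub> g) ` D = E"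
    using bl.act_mult[of h "inv\<^bsub>SL q\<^esub> g" D] bl.act_inv(1)[of g S] S_block assms by simp
  then show ?thesis using gh by blast
qed

lemma blocks_disjoint:
  assumes "D \<in> blocks" "E \<in> blocks" "x \<in> D" "x \<in> E"
  shows "D = E"
proof -
  obtain g h where gh: "g \<in> carrier (SL q)" "D = act g ` S" "h \<in> carrier (SL q)" "E = act h ` S"
    using assms by (auto simp: blocks_def)
  let ?k = "inv\<^bsub>SL q\<^esub> g \<otimes>\<^bsub>SL q\<^esub> h"
  have k: "?k \<in> carrier (SL q)" using gh by simp
  have kS: "act ?k ` S = act (inv\<^bsub>SL q\<^esub> g) ` E"
    using gh image_mult S_sub by simp
  have gE: "act (inv\<^bsub>SL q\<^esub> g) ` D = S"
    using gh bl.act_inv(1)[OF gh(1) S_block] by simp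
  have "act (inv\<^bsub>SL q\<^esub> g) x \<in> act ?k ` S \<inter> S"
    using kS gE assms(3,4) by blast
  then have "act ?k ` S = S" using block[OF k] by blast
  then have "act (inv\<^bsub>SL q\<^esub> g) ` D = act (inv\<^bsub>SL q\<^esub> g) ` E" using kS gE by simp
  then show ?thesis using bl.act_inj[of "inv\<^bsub>SL q\<^esub> g" D E] gh assms by simp
qed

lemma Union_blocks: "\<Union>blocks = \<Omega>"
proof
  show "\<Union>blocks \<subseteq> \<Omega>" using blocks_sub by blast
  obtain s where s: "s \<in> S" using card_S(1) by fastforce
  show "\<Omega> \<subseteq> \<Union>blocks"
  proof
    fix x assume "x \<in> \<Omega>"
    then obtain g where "g \<in> carrier (SL q)" "act g s = x" using trans s S_sub by blast
    then show "x \<in> \<Union>blocks" using s by (auto simp: blocks_def)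
  qed
qed

lemma card_block: "D \<in> blocks \<Longrightarrow> card D = card S"
  using inj_on_act S_sub by (auto simp: blocks_def intro!: card_image intro: inj_on_subset)

lemma card_blocks_mult: "card blocks * card S = p * q"
proof -
  have "card (\<Union>blocks) = (\<Sum>D\<in>blocks. card D)"
  proof (rule card_Union_disjoint)
    show "disjoint blocks" using blocks_disjoint unfolding pairwise_def disjnt_def by blast
    show "finite D" if "D \<in> blocks" for D using blocks_sub[OF that] finite_Omega by (rule finite_subset)
  qed
  then show ?thesis using Union_blocks card_Omega card_block by simp
qed

lemma subgroup_carrier: "subgroup (carrier (SL q)) (SL q :: 'k mat monoid)"
  by (rule sl.subgroup_self)

text \<open>
  On \<open>q\<close> points every elementary transvection acts trivially, as there is a third index.
\<close>

lemma card_blocks_neq_q: "card blocks \<noteq> q"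
proof
  assume q: "card blocks = q"
  have K: "set_action (SL q\<lparr>carrier := carrier (SL q)\<rparr>) blocks (\<lambda>g D. act g ` D)"
    by (rule bl.set_action_subgroup[OF subgroup_carrier order_refl]) (rule image_block)
  show False
  proof (rule transvections_act_nontrivially[OF subgroup_carrier K q prime_q, where d = 0])
    fix i j t D assume ij: "i < q" "j < q" "i \<noteq> j" and D: "D \<in> blocks"
    have "card {i, j} < card {..<q}" using q_ge_3 ij by simp
    then obtain k where k: "k < q" "k \<noteq> i" "k \<noteq> j"
      by (metis card_mono finite.emptyI finite.insertI insert_iff lessThan_iff not_le subsetI)
    show "act (addrow_mat q t i j) ` D = D"
      using elementary_act_trivially[OF subgroup_carrier K q ij(1,2) k(1) ij(3) _ _ _ _ _ D]
        k ij by (simp add: addrow_mat_SL)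
  qed (use blocks_trans not_dvd_q_minus_1 addrow_mat_SL in \<open>auto simp: block_upper_def\<close>)
qed

lemma card_S_q: "card S = q" and card_blocks: "card blocks = p"
  using prime_mult_cases[OF prime_p prime_q card_blocks_mult card_S(1)] card_S(2) card_Omega
    card_blocks_neq_q by auto

lemma finite_blocks: "finite blocks"
  using card_blocks prime_p by (metis card.infinite not_prime_0)

abbreviation stab_block :: "'x set \<Rightarrow> 'k mat set" where
  "stab_block \<equiv> bl.stab"

lemma stab_block_carrier: "D \<in> blocks \<Longrightarrow> stab_block D \<subseteq> carrier (SL q)"
  by (auto simp: bl.stab_def)

text \<open>
  The group of elations with center the first unit vector is a \<open>q\<close>-group and \<open>p\<close> is not divisible by
  \<open>q\<close>, so it fixes a block.
\<close>

lemma ex_elation_block: "\<exists>D\<in>blocks. unit_col q 0 \<in> transvection_centers q (stab_block D)"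
proof -
  have A: "set_action (SL q\<lparr>carrier := elations\<rparr>) blocks (\<lambda>g D. act g ` D)"
  proof (rule bl.set_action_subgroup[OF subgroup_elations order_refl])
    fix g D assume "g \<in> elations" "D \<in> blocks"
    then show "act g ` D \<in> blocks"
      using image_block subgroup.mem_carrier[OF subgroup_elations] by blast
  qed
  interpret A: set_action "SL q\<lparr>carrier := elations\<rparr>" blocks "\<lambda>g D. act g ` D" by (rule A)
  have o: "Coset.order (SL q\<lparr>carrier := elations\<rparr>) = q ^ (q - 1)"
    by (simp add: Coset.order_def card_elations)
  have "\<not> q dvd card blocks" by (simp add: card_blocks not_q_dvd_p)
  then obtain D where D: "D \<in> blocks" "\<forall>g\<in>elations. act g ` D = D"
    using A.prime_power_fixed_point[OF o prime_q finite_blocks] by auto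
  then have "elations \<subseteq> stab_block D"
    using subgroup.subset[OF subgroup_elations] unfolding bl.stab_def by blast
  then show ?thesis using D(1) unfolding unit_col_0_center_iff by blast
qed

lemma centers_image:
  assumes "D \<in> blocks" "g \<in> carrier (SL q)" "v \<in> transvection_centers q (stab_block D)"
  shows "g * v \<in> transvection_centers q (stab_block (act g ` D))"
proof (rule transvection_centers_conj[OF assms(2,3) stab_block_carrier[OF assms(1)]])
  fix k assume k: "k \<in> stab_block D"
  then have "act (g \<otimes>\<^bsub>SL q\<^esub> k \<otimes>\<^bsub>SL q\<^esub> inv\<^bsub>SL q\<^esub> g) ` (act g ` D) = act g ` D"
    using assms bl.act_mult[of "g \<otimes>\<^bsub>SL q\<^esub> k" "inv\<^bsub>SL q\<^esub> g" "act g ` D"] image_block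
      bl.act_inv(1)[of g D] bl.act_mult[of g k D] by (simp add: bl.stab_def)
  then show "g \<otimes>\<^bsub>SL q\<^esub> k \<otimes>\<^bsub>SL q\<^esub> inv\<^bsub>SL q\<^esub> g \<in> stab_block (act g ` D)"
    using k assms by (simp add: bl.stab_def)
qed

text \<open>
  If one block stabilizer contained all transvections, then all would, and the transvections would
  act trivially on the blocks.
\<close>

lemma not_all_centers:
  assumes D: "D \<in> blocks"
  shows "\<exists>i<q. unit_col q i \<notin> transvection_centers q (stab_block D)"
proof (rule ccontr)
  assume "\<not> ?thesis"
  then have u: "unit_col q i \<in> transvection_centers q (stab_block D)" if "i < q" for i
    using that by blast
  let ?W = "transvection_centers q (stab_block D)"
  have W: "v \<in> ?W" if v: "v \<in> carrier_mat q 1" for v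
  proof (rule echelon_span[where d = q and W = ?W and n = q])
    fix k assume "k < q"
    then show "\<exists>w\<in>?W. w $$ (k, 0) \<noteq> 0 \<and> (\<forall>i<q. k < i \<longrightarrow> w $$ (i, 0) = 0)"
      using u[of k] by (intro bexI[of _ "unit_col q k"]) (auto simp: unit_col_def)
  qed (use v q_ge_3 transvection_centers_add[OF bl.subgroup_stab[OF D]] transvection_centers_smult
      transvection_centersD(1) in auto)
  have all: "unit_col q i \<in> transvection_centers q (stab_block E)" if E: "E \<in> blocks" for i E
  proof -
    obtain g where g: "g \<in> carrier (SL q)" "act g ` D = E" using blocks_trans[OF D E] by blast
    have v: "inv\<^bsub>SL q\<^esub> g * unit_col q i \<in> carrier_mat q 1"
      using g cols.act_closed[of "inv\<^bsub>SL q\<^esub> g" "unit_col q i"] by simp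
    have "g * (inv\<^bsub>SL q\<^esub> g * unit_col q i) = unit_col q i"
      using g by (intro cols.act_inv) auto
    then show ?thesis using centers_image[OF D g(1) W[OF v]] g(2) by simp
  qed
  have K: "set_action (SL q\<lparr>carrier := carrier (SL q)\<rparr>) blocks (\<lambda>g D. act g ` D)"
    by (rule bl.set_action_subgroup[OF subgroup_carrier order_refl]) (rule image_block)
  show False
  proof (rule transvections_act_nontrivially[OF subgroup_carrier K card_blocks prime_p, where d = 0])
    fix i j t E assume ij: "i < q" "j < q" "i \<noteq> j" and E: "E \<in> blocks"
    have "addrow_mat q t i j \<in> stab_block E"
      using addrow_mat_if_unit_col_center[OF all[OF E] ij] .
    then show "act (addrow_mat q t i j) ` E = E" by (simp add: bl.stab_def)
  qed (use blocks_trans not_dvd_q_minus_1 addrow_mat_SL in \<open>auto simp: block_upper_def\<close>)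
qed

text \<open>
  The Artin-Schreier matrix satisfies \<open>c\<^sup>p = 1\<close>; if it fixed one of the \<open>p\<close> blocks, it would fix all,
  in particular one for which the first unit vector is a center. As it maps each unit vector but the
  last to the next one, all unit vectors would be centers for that block.
\<close>

lemma artin_schreier_moves_blocks:
  assumes D: "D \<in> blocks"
  shows "act artin_schreier ` D \<noteq> D"
proof
  assume fixed: "act artin_schreier ` D = D"
  obtain E where E: "E \<in> blocks" and e: "unit_col q 0 \<in> transvection_centers q (stab_block E)"
    using ex_elation_block by blast
  have "act artin_schreier ` E = E"
    using bl.trivial_if_fixed_point[OF artin_schreier_SL card_blocks prime_p _ D fixed E]
      artin_schreier_pow_p[OF p_eq] bl.act_one by simp
  then have c: "artin_schreier \<in> stab_block E" by (simp add: bl.stab_def artin_schreier_SL)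
  have "unit_col q i \<in> transvection_centers q (stab_block E)" if "i < q" for i
    using that
  proof (induction i)
    case (Suc i)
    then show ?case
      using transvection_centers_invariant[OF bl.subgroup_stab[OF E] c]
      by (metis Suc_lessD artin_schreier_unit_col)
  qed (rule e)
  then show False using not_all_centers[OF E] by blast
qed

lemma ex_block: "x \<in> \<Omega> \<Longrightarrow> \<exists>D\<in>blocks. x \<in> D"
  using Union_blocks by blast

lemma image_block_if_fixed:
  assumes "D \<in> blocks" "g \<in> carrier (SL q)" "x \<in> D" "act g x \<in> D"
  shows "act g ` D = D"
  using blocks_disjoint[OF image_block[OF assms(2,1)] assms(1), of "act g x"] assms by blast

lemma artin_schreier_fixed_point_free:
  assumes "x \<in> \<Omega>"
  shows "act artin_schreier x \<noteq> x"
proof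
  assume fixed: "act artin_schreier x = x"
  obtain D where D: "D \<in> blocks" "x \<in> D" using ex_block[OF assms] by blast
  then have "act artin_schreier ` D = D"
    using fixed by (intro image_block_if_fixed[OF _ artin_schreier_SL D(2)]) auto
  then show False using artin_schreier_moves_blocks D by blast
qed

lemma stab_block_index:
  assumes D: "D \<in> blocks"
  shows "p * card (stab_block D) = Coset.order (SL q :: 'k mat monoid)"
proof -
  have "(\<lambda>g. act g ` D) ` carrier (SL q) = blocks"
    using blocks_trans[OF D] image_block[OF _ D] by blast
  then show ?thesis using bl.orbit_stab[OF D] card_blocks by simp
qed

text \<open>
  The block stabilizers have prime index \<open>p\<close>.
\<close>

lemma stab_block_maximal:
  assumes D: "D \<in> blocks" and T: "subgroup T (SL q)" "stab_block D \<subseteq> T"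
  shows "T = stab_block D \<or> T = carrier (SL q)"
proof -
  have fin: "finite (carrier (SL q :: 'k mat monoid))" by (rule finite_carrier_SL)
  have TG: "T \<subseteq> carrier (SL q)" using subgroup.subset[OF T(1)] .
  have finT: "finite T" using TG fin by (rule finite_subset)
  obtain a where a: "card T = card (stab_block D) * a"
    using sl.card_subgroup_dvd[OF bl.subgroup_stab[OF D] T] by (auto simp: dvd_def)
  obtain b where b: "card (carrier (SL q :: 'k mat monoid)) = card T * b"
    using sl.card_subgroup_dvd[OF T(1) subgroup_carrier TG] by (auto simp: dvd_def)
  have "card (carrier (SL q :: 'k mat monoid)) > 0"
    using fin sl.one_closed by (metis card_gt_0_iff empty_iff)
  moreover have "p * card (stab_block D) = card (stab_block D) * a * b"
    using stab_block_index[OF D] a b by (simp add: Coset.order_def)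
  ultimately have "p = a * b" using a b by auto
  then have "a = 1 \<or> b = 1"
    using prime_p by (metis dvd_triv_left mult.right_neutral mult_cancel1 not_prime_0 prime_nat_iff)
  then show ?thesis
  proof
    assume "a = 1"
    then show ?thesis using a card_subset_eq[OF finT T(2)] by simp
  next
    assume "b = 1"
    then show ?thesis using b card_subset_eq[OF fin TG] by simp
  qed
qed

text \<open>
  If the Pascal matrix fixes a block, then the centers for this block form a proper nonzero member
  of the flag of the Pascal matrix.
\<close>

lemma block_stab_flag:
  assumes D: "D \<in> blocks" and f: "pascal \<in> stab_block D"
  obtains d where "0 < d" "d < q"
    "transvection_centers q (stab_block D) = {v \<in> carrier_mat q 1. \<forall>i<q. d \<le> i \<longrightarrow> v $$ (i, 0) = 0}"
proof -
  let ?W = "transvection_centers q (stab_block D)"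
  note sub = bl.subgroup_stab[OF D]
  obtain E where E: "E \<in> blocks" and e: "unit_col q 0 \<in> transvection_centers q (stab_block E)"
    using ex_elation_block by blast
  obtain g where g: "g \<in> carrier (SL q)" "act g ` E = D" using blocks_trans[OF E D] by blast
  define u where "u = g * unit_col q 0"
  have uW: "u \<in> ?W" using centers_image[OF E g(1) e] g(2) by (simp add: u_def)
  note uc = transvection_centersD(1)[OF uW]
  have "\<exists>i<q. u $$ (i, 0) \<noteq> 0"
  proof (rule ccontr)
    assume z: "\<not> ?thesis"
    have "u = 0\<^sub>m q 1" using z uc by (intro eq_matI) auto
    moreover have "g * 0\<^sub>m q 1 = 0\<^sub>m q 1"
      by (rule right_mult_zero_mat[OF carrier_mat_if_SL[OF g(1)]])
    ultimately have "g * unit_col q 0 = g * 0\<^sub>m q 1" by (simp add: u_def)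
    then have "unit_col q 0 = (0\<^sub>m q 1 :: 'k mat)"
      by (rule cols.act_inj[OF g(1) unit_col_carrier zero_carrier_mat])
    then have "(unit_col q 0 :: 'k mat) $$ (0, 0) = (0\<^sub>m q 1 :: 'k mat) $$ (0, 0)" by simp
    then show False using q_ge_3 by (simp add: unit_col_def)
  qed
  then obtain i where i: "i < q" "u $$ (i, 0) \<noteq> 0" by blast
  obtain d where d: "0 < d" "d \<le> q" "?W = {v \<in> carrier_mat q 1. \<forall>i<q. d \<le> i \<longrightarrow> v $$ (i, 0) = 0}"
  proof (rule pascal_invariant_subspace[of ?W u i])
    show "pascal * v \<in> ?W" if "v \<in> ?W" for v
      using transvection_centers_invariant[OF sub f that] .
  qed (use transvection_centers_add[OF sub] transvection_centers_smult transvection_centersD(1)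
      uW i in auto)
  have "d \<noteq> q"
  proof
    assume "d = q"
    then have "unit_col q i \<in> ?W" for i using d(3) by auto
    then show False using not_all_centers[OF D] by blast
  qed
  then show ?thesis using that[OF d(1) _ d(3)] d(2) by simp
qed

text \<open>
  As a maximal subgroup, the block stabilizer is then the full stabilizer of that member of the flag;
  so it consists of block triangular matrices and contains all block triangular elementary
  transvections.
\<close>

lemma block_stab_parabolic:
  assumes D: "D \<in> blocks"
    and d: "0 < d" "d < q"
    and W: "transvection_centers q (stab_block D) =
      {v \<in> carrier_mat q 1. \<forall>i<q. d \<le> i \<longrightarrow> v $$ (i, 0) = 0}"
  shows "\<And>g. g \<in> stab_block D \<Longrightarrow> block_upper d g"
    and "\<And>i j t. \<lbrakk>i < q; j < q; i \<noteq> j; i < d \<or> d \<le> j\<rbrakk> \<Longrightarrow> addrow_mat q t i j \<in> stab_block D"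
proof -
  let ?W = "transvection_centers q (stab_block D)"
  note sub = bl.subgroup_stab[OF D]
  fix g assume g: "g \<in> stab_block D"
  then have gc: "g \<in> carrier_mat q q" using stab_block_carrier[OF D] carrier_mat_if_SL by blast
  have "g $$ (i, j) = 0" if "i < q" "j < q" "d \<le> i" "j < d" for i j
  proof -
    have "unit_col q j \<in> ?W" using that unfolding W by (auto simp: unit_col_def)
    then have "g * unit_col q j \<in> ?W" by (rule transvection_centers_invariant[OF sub g])
    then show ?thesis using that index_mult_unit_col[OF gc, of i j] unfolding W by simp
  qed
  then show "block_upper d g" using gc by (auto simp: block_upper_def)
next
  let ?W = "transvection_centers q (stab_block D)"
  note sub = bl.subgroup_stab[OF D]
  define T where "T = {g \<in> carrier (SL q). \<forall>v\<in>carrier_mat q 1. g * v \<in> ?W \<longleftrightarrow> v \<in> ?W}"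
  have T: "subgroup T (SL q)"
  proof (rule sl.subgroupI)
    show "T \<subseteq> carrier (SL q)" by (auto simp: T_def)
    have "\<one>\<^bsub>SL q\<^esub> \<in> T" using cols.act_one by (simp add: T_def)
    then show "T \<noteq> {}" by blast
  next
    fix a assume a: "a \<in> T"
    then have aG: "a \<in> carrier (SL q)" by (simp add: T_def)
    have "inv\<^bsub>SL q\<^esub> a * v \<in> ?W \<longleftrightarrow> v \<in> ?W" if v: "v \<in> carrier_mat q 1" for v
    proof -
      have c: "inv\<^bsub>SL q\<^esub> a * v \<in> carrier_mat q 1" using aG v by (intro cols.act_closed) auto
      then have "a * (inv\<^bsub>SL q\<^esub> a * v) \<in> ?W \<longleftrightarrow> inv\<^bsub>SL q\<^esub> a * v \<in> ?W"
        using a by (simp add: T_def)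
      then show ?thesis using cols.act_inv(2)[OF aG v] by simp
    qed
    then show "inv\<^bsub>SL q\<^esub> a \<in> T" using aG by (simp add: T_def)
  next
    fix a b assume "a \<in> T" "b \<in> T"
    then show "a \<otimes>\<^bsub>SL q\<^esub> b \<in> T"
      using cols.act_mult[of a b] cols.act_closed[of b] by (auto simp: T_def)
  qed
  have KT: "stab_block D \<subseteq> T"
  proof
    fix g assume g: "g \<in> stab_block D"
    then have gG: "g \<in> carrier (SL q)" using stab_block_carrier[OF D] by blast
    have "g * v \<in> ?W \<longleftrightarrow> v \<in> ?W" if v: "v \<in> carrier_mat q 1" for v
      using transvection_centers_invariant[OF sub g, of v] cols.act_inv(1)[OF gG v]
        transvection_centers_invariant[OF sub subgroup.m_inv_closed[OF sub g], of "g * v"] by auto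
    then show "g \<in> T" using gG by (simp add: T_def)
  qed
  have "T \<noteq> carrier (SL q)"
  proof
    assume "T = carrier (SL q)"
    then have "artin_schreier [^]\<^bsub>SL q\<^esub> d \<in> T" using artin_schreier_SL by simp
    moreover have "unit_col q 0 \<in> ?W" using d unfolding W by (auto simp: unit_col_def)
    ultimately have "artin_schreier [^]\<^bsub>SL q\<^esub> d * unit_col q 0 \<in> ?W"
      unfolding T_def using unit_col_carrier by blast
    then have "unit_col q d \<in> ?W" unfolding artin_schreier_pow_unit_col[OF d(2)] .
    then show False using d unfolding W by (auto simp: unit_col_def)
  qed
  then have TK: "T = stab_block D" using stab_block_maximal[OF D T KT] by blast
  fix i j :: nat and t :: 'k assume ij: "i < q" "j < q" "i \<noteq> j" "i < d \<or> d \<le> j"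
  let ?E = "addrow_mat q t i j"
  have E: "?E \<in> carrier (SL q)" using ij(3) by (rule addrow_mat_SL)
  have "?E * v \<in> ?W \<longleftrightarrow> v \<in> ?W" if v: "v \<in> carrier_mat q 1" for v
  proof -
    have ent: "(?E * v) $$ (k, 0) = (if k = i then v $$ (k, 0) + t * v $$ (j, 0) else v $$ (k, 0))"
      if "k < q" for k using index_addrow_mat_mult[OF v ij(2) that, of 0 t i] by simp
    have "(\<forall>k<q. d \<le> k \<longrightarrow> (?E * v) $$ (k, 0) = 0) \<longleftrightarrow> (\<forall>k<q. d \<le> k \<longrightarrow> v $$ (k, 0) = 0)"
    proof (intro iffI allI impI)
      fix k assume L: "\<forall>k<q. d \<le> k \<longrightarrow> (?E * v) $$ (k, 0) = 0" and k: "k < q" "d \<le> k"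
      show "v $$ (k, 0) = 0"
      proof (cases "k = i")
        case True
        then have "d \<le> j" using ij k by simp
        then have "v $$ (j, 0) = 0" using L ent[OF ij(2)] ij by metis
        then show ?thesis using L k ent[OF k(1)] True by simp
      next
        case False
        then show ?thesis using L k ent[OF k(1)] by metis
      qed
    next
      fix k assume R: "\<forall>k<q. d \<le> k \<longrightarrow> v $$ (k, 0) = 0" and k: "k < q" "d \<le> k"
      then have "k = i \<Longrightarrow> v $$ (j, 0) = 0" using ij by simp
      then show "(?E * v) $$ (k, 0) = 0" unfolding ent[OF k(1)] using R k by simp
    qed
    moreover have "?E * v \<in> carrier_mat q 1" using v by simp
    ultimately show ?thesis using v unfolding W by blast
  qed
  then have "?E \<in> T" using E unfolding T_def by blast
  then show "?E \<in> stab_block D" unfolding TK .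
qed

text \<open>
  The elementary transvections of a parabolic subgroup that are commutators act trivially on
  the block \<open>D\<close>; only a diagonal block of size two contains others. There is at most one such
  block, as \<open>q\<close> is odd, and then the Pascal matrix acts on \<open>D\<close> like one of its elementary
  transvections.
\<close>

lemma pascal_fixed_point_free:
  assumes x: "x \<in> \<Omega>"
  shows "act pascal x \<noteq> x"
proof
  assume fixed: "act pascal x = x"
  obtain D where D: "D \<in> blocks" and xD: "x \<in> D" using ex_block[OF x] by blast
  let ?K = "stab_block D"
  have f: "pascal \<in> ?K"
    using image_block_if_fixed[OF D pascal_SL xD] fixed xD by (simp add: bl.stab_def pascal_SL)
  obtain d where d: "0 < d" "d < q" and W: "transvection_centers q ?K =
      {v \<in> carrier_mat q 1. \<forall>i<q. d \<le> i \<longrightarrow> v $$ (i, 0) = 0}"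
    using block_stab_flag[OF D f] by blast
  note par = block_stab_parabolic[OF D d W]
  note sub = bl.subgroup_stab[OF D]
  have K: "set_action (SL q\<lparr>carrier := ?K\<rparr>) D act"
    by (rule om.set_action_subgroup[OF sub blocks_sub[OF D]]) (auto simp: bl.stab_def)
  interpret K: set_action "SL q\<lparr>carrier := ?K\<rparr>" D act by (rule K)
  have cardD: "card D = q" using card_block[OF D] card_S_q by simp
  have comm: "act (addrow_mat q t i j) y = y"
    if ij: "i < q" "j < q" "i \<noteq> j" "i < d \<or> d \<le> j" and y: "y \<in> D"
      and nb: "\<not> (d = 2 \<and> i < d \<and> j < d)" "\<not> (d + 2 = q \<and> d \<le> i \<and> d \<le> j)" for i j t y
  proof -
    \<comment> \<open>A third index \<open>k\<close> such that the transvections at \<open>(i, k)\<close> and \<open>(k, j)\<close> stabilize the block.\<close>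
    have "\<exists>k<q. k \<noteq> i \<and> k \<noteq> j \<and> (i < d \<or> d \<le> k) \<and> (k < d \<or> d \<le> j)"
    proof -
      consider "i < d" "d \<le> j" | "i < d" "j < d" | "d \<le> i" "d \<le> j" using ij(4) by linarith
      then show ?thesis
      proof cases
        case 1
        have "\<not> {..<q} \<subseteq> {i, j}"
          using card_mono[of "{i, j}" "{..<q}"] q_ge_3 ij by auto
        then show ?thesis using 1 by auto
      next
        case 2
        then have "3 \<le> d" using nb ij by linarith
        then have "\<not> {..<d} \<subseteq> {i, j}" using card_mono[of "{i, j}" "{..<d}"] ij by auto
        then obtain k where "k < d" "k \<noteq> i" "k \<noteq> j" by blast
        then show ?thesis using 2 d by (intro exI[of _ k]) auto
      next
        case 3
        then have "d + 3 \<le> q" using nb ij by linarith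
        then have "\<not> {d..<q} \<subseteq> {i, j}" using card_mono[of "{i, j}" "{d..<q}"] ij by auto
        then show ?thesis using 3 by auto
      qed
    qed
    then obtain k where k: "k < q" "k \<noteq> i" "k \<noteq> j" "i < d \<or> d \<le> k" "k < d \<or> d \<le> j" by blast
    show ?thesis
      by (rule elementary_act_trivially[OF sub K cardD ij(1,2) k(1) ij(3)]) (use k ij y par(2) in auto)
  qed
  define M where "M = {g \<in> ?K. \<forall>y\<in>D. act g y = y}"
  have two: "addrow_mat q t a (Suc a) \<in> M \<and> addrow_mat q t (Suc a) a \<in> M"
    if a: "(d = 2 \<and> a = 0) \<or> (d + 2 = q \<and> a = d)" for a t
  proof -
    have M: "subgroup M (SL q)" unfolding M_def by (rule sl.subgroup_acting_trivially[OF sub K])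
    have aq: "Suc a < q" using a d by auto
    have side: "k < d \<or> d \<le> l" if "{k, l} = {a, Suc a}" for k l
      using that a by (auto simp: doubleton_eq_iff)
    \<comment> \<open>The entry of the Pascal matrix at \<open>(a, a + 1)\<close>; removing it leaves an element of \<open>M\<close>.\<close>
    define s where "s = (of_nat (Suc a) :: 'k)"
    have s: "s \<noteq> 0" unfolding s_def using aq by (intro of_nat_neq_0) auto
    let ?E = "addrow_mat q (- s) a (Suc a)"
    have EK: "?E \<in> ?K" using par(2)[of a "Suc a"] aq side[of a "Suc a"] by auto
    have ent: "(?E * pascal) $$ (i, j) = (if i = a then pascal $$ (i, j) + (- s) * pascal $$ (Suc a, j)
        else pascal $$ (i, j))" if "i < q" "j < q" for i j
      using index_addrow_mat_mult[OF pascal_carrier aq that] .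
    have "?E * pascal \<in> M"
    proof (rule unitriangular_mem_subgroup[OF _ _ _ aq _ M])
      show "?E * pascal \<in> carrier (SL q)"
        using subgroup_SL_mult[OF sub EK f] stab_block_carrier[OF D] by blast
      show "(?E * pascal) $$ (i, i) = 1" if "i < q" for i
        using ent[OF that that] that aq by (auto simp: pascal_def binomial_eq_0)
      show "(?E * pascal) $$ (i, j) = 0" if "i < q" "j < i" for i j
        using ent[of i j] that aq by (auto simp: pascal_def binomial_eq_0)
      show "(?E * pascal) $$ (a, Suc a) = 0"
        using ent[of a "Suc a"] aq by (simp add: pascal_def s_def)
      show "addrow_mat q t i j \<in> M" if "i < j" "j < q" "(i, j) \<noteq> (a, Suc a)" for i j t
      proof -
        have ijd: "i < d \<or> d \<le> j" using that by linarith
        have nb: "\<not> (d = 2 \<and> i < d \<and> j < d)" "\<not> (d + 2 = q \<and> d \<le> i \<and> d \<le> j)"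
          using a that odd_q by auto
        show ?thesis
          using that ijd comm[OF _ _ _ ijd _ nb] par(2)[OF _ _ _ ijd] by (auto simp: M_def)
      qed
    qed
    then have "act ?E (act pascal x) = x"
      using K.act_mult[of ?E pascal x] EK f xD by (simp add: M_def mult_SL)
    then have Ex: "act ?E x = x" by (simp add: fixed)
    have Etriv: "act ?E y = y" if y: "y \<in> D" for y
      by (rule K.trivial_if_fixed_point[OF _ cardD prime_q _ xD Ex y])
        (use EK K.act_one addrow_mat_pow_q[of a "Suc a"] aq in \<open>auto simp: nat_pow_SL_subgroup\<close>)
    have up: "act (addrow_mat q t a (Suc a)) y = y" if y: "y \<in> D" for y t
    proof -
      obtain m where m: "t / - s = of_nat m" using ex_of_nat by blast
      have "t = (t / - s) * (- s)" using s by simp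
      then have "t = of_nat m * (- s)" unfolding m .
      then have "addrow_mat q t a (Suc a) = ?E [^]\<^bsub>SL q\<lparr>carrier := ?K\<rparr>\<^esub> m"
        using addrow_mat_pow[of a "Suc a" q "- s" m] aq by (simp add: nat_pow_SL_subgroup)
      then show ?thesis using K.act_pow_fixed[of ?E y m] EK y Etriv[OF y] by simp
    qed
    have upK: "addrow_mat q t a (Suc a) \<in> ?K" for t
      using par(2)[of a "Suc a"] aq side[of a "Suc a"] by auto
    have downK: "addrow_mat q t (Suc a) a \<in> ?K" for t
      using par(2)[of "Suc a" a] aq side[of "Suc a" a] by auto
    define w where "w = addrow_mat q 1 a (Suc a) *
      (addrow_mat q (- 1) (Suc a) a * addrow_mat q (1 :: 'k) a (Suc a))"
    have wK: "w \<in> ?K" unfolding w_def using upK downK subgroup_SL_mult[OF sub] by blast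
    have down: "act (addrow_mat q t (Suc a) a) y = y" if y: "y \<in> D" for y
    proof -
      have rel: "addrow_mat q t (Suc a) a * w = w * addrow_mat q (- t) a (Suc a)"
        unfolding w_def using aq by (intro addrow_mat_weyl) auto
      define z where "z = act (inv\<^bsub>SL q\<lparr>carrier := ?K\<rparr>\<^esub> w) y"
      have z: "z \<in> D" "act w z = y"
        unfolding z_def using wK y K.act_inv(2)[of w y] K.act_closed[of "inv\<^bsub>SL q\<lparr>carrier := ?K\<rparr>\<^esub> w" y]
          K.inv_closed[of w] by auto
      have "act (addrow_mat q t (Suc a) a) (act w z) = act w (act (addrow_mat q (- t) a (Suc a)) z)"
        using K.act_mult[of "addrow_mat q t (Suc a) a" w z] wK downK upK z(1) rel
          K.act_mult[of w "addrow_mat q (- t) a (Suc a)" z] by (simp add: mult_SL)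
      then show ?thesis using up[OF z(1)] z(2) by simp
    qed
    show ?thesis using up down upK downK by (simp add: M_def)
  qed
  show False
  proof (rule transvections_act_nontrivially[OF sub K cardD prime_q not_dvd_q_minus_1(1) _ par])
    show "\<exists>g\<in>?K. act g y = z" if yz: "y \<in> D" "z \<in> D" for y z
    proof -
      obtain g where g: "g \<in> carrier (SL q)" "act g y = z"
        using trans yz blocks_sub[OF D] by blast
      then have "g \<in> ?K" using image_block_if_fixed[OF D g(1) yz(1)] yz by (simp add: bl.stab_def)
      with g show ?thesis by blast
    qed
    fix i j t y assume ij: "i < q" "j < q" "i \<noteq> j" "i < d \<or> d \<le> j" and y: "y \<in> D"
    consider "d = 2" "i < d" "j < d" | "d + 2 = q" "d \<le> i" "d \<le> j"
      | "\<not> (d = 2 \<and> i < d \<and> j < d)" "\<not> (d + 2 = q \<and> d \<le> i \<and> d \<le> j)" by blast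
    then show "act (addrow_mat q t i j) y = y"
    proof cases
      case 1
      then have "(i = 0 \<and> j = Suc 0) \<or> (i = Suc 0 \<and> j = 0)" using ij(3) by auto
      then show ?thesis using two[of 0 t] 1 y by (auto simp: M_def)
    next
      case 2
      then have "(i = d \<and> j = Suc d) \<or> (i = Suc d \<and> j = d)" using ij by auto
      then show ?thesis using two[of d t] 2 y by (auto simp: M_def)
    next
      case 3
      then show ?thesis using comm[OF ij y] by blast
    qed
  qed
qed

end

section \<open>Intersection density\<close>

text \<open>
  The clique-coclique bound. A family of \<open>card \<Omega>\<close> permutations in \<open>P\<close>, any two of which agree nowhere,
  bounds every intersecting family by the order of a point stabilizer, which is itself intersecting:
  if \<open>g\<close>, \<open>h\<close> agree at some point, then \<open>g \<circ> n\<^sub>i = h \<circ> n\<^sub>j\<close> forces \<open>i = j\<close>.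
\<close>

lemma intersection_density_eq_1_if_clique:
  fixes n :: "'i \<Rightarrow> 'a \<Rightarrow> 'a"
  assumes P: "transitive_perm_group \<Omega> P" and fin: "finite \<Omega>" and \<omega>: "\<omega> \<in> \<Omega>"
    and I: "card I = card \<Omega>" and n: "\<And>i. i \<in> I \<Longrightarrow> n i \<in> P"
    and clique: "\<And>i j x. \<lbrakk>i \<in> I; j \<in> I; x \<in> \<Omega>; n i x = n j x\<rbrakk> \<Longrightarrow> i = j"
  shows "intersection_density \<Omega> P \<omega> = 1"
proof -
  interpret B: group "BijGroup \<Omega>" by (rule group_BijGroup)
  have sub: "subgroup P (BijGroup \<Omega>)" and trans: "\<And>x y. \<lbrakk>x \<in> \<Omega>; y \<in> \<Omega>\<rbrakk> \<Longrightarrow> \<exists>g\<in>P. g x = y"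
    using P by (auto simp: transitive_perm_group_def)
  have PB: "P \<subseteq> Bij \<Omega>" using subgroup.subset[OF sub] by (simp add: BijGroup_def)
  have bij: "bij_betw g \<Omega> \<Omega>" "g \<in> extensional \<Omega>" if "g \<in> P" for g
    using that PB by (auto simp: Bij_def)
  have closed: "g x \<in> \<Omega>" if "g \<in> P" "x \<in> \<Omega>" for g x
    using bij_betw_imp_surj_on[OF bij(1)[OF that(1)]] that(2) by blast
  have surj: "\<exists>x\<in>\<Omega>. g x = y" if "g \<in> P" "y \<in> \<Omega>" for g y
    using bij_betw_imp_surj_on[OF bij(1)[OF that(1)]] that(2) by (metis imageE)
  have mult: "g \<otimes>\<^bsub>BijGroup \<Omega>\<^esub> h = compose \<Omega> g h" if "g \<in> P" "h \<in> P" for g h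
    using that PB by (auto simp: BijGroup_def)
  interpret S: group "BijGroup \<Omega>\<lparr>carrier := P\<rparr>" by (rule B.subgroup_imp_group[OF sub])
  interpret S: set_action "BijGroup \<Omega>\<lparr>carrier := P\<rparr>" \<Omega> "\<lambda>g x. g x"
  proof unfold_locales
    show "g x \<in> \<Omega>" if "g \<in> carrier (BijGroup \<Omega>\<lparr>carrier := P\<rparr>)" "x \<in> \<Omega>" for g x
      using closed that by simp
    show "(g \<otimes>\<^bsub>BijGroup \<Omega>\<lparr>carrier := P\<rparr>\<^esub> h) x = g (h x)"
      if "g \<in> carrier (BijGroup \<Omega>\<lparr>carrier := P\<rparr>)" "h \<in> carrier (BijGroup \<Omega>\<lparr>carrier := P\<rparr>)" "x \<in> \<Omega>"
      for g h x using mult[of g h] that by (simp add: compose_eq)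
  qed (simp add: BijGroup_def)
  have "P \<subseteq> \<Omega> \<rightarrow>\<^sub>E \<Omega>" using bij by (auto simp: PiE_def bij_betw_def)
  then have finP: "finite P" using fin by (meson finite_PiE finite_subset)
  have st: "S.stab \<omega> = point_stabilizer P \<omega>"
    by (auto simp: S.stab_def point_stabilizer_def)
  have "(\<lambda>g. g \<omega>) ` P = \<Omega>" using trans \<omega> bij(1) by (fastforce simp: bij_betw_def)
  then have ord: "card \<Omega> * card (point_stabilizer P \<omega>) = card P"
    using S.orbit_stab[OF \<omega>] st by (simp add: Coset.order_def)
  have card0: "card \<Omega> > 0" using \<omega> fin by (auto simp: card_gt_0_iff)
  have "P \<noteq> {}" using subgroup.one_closed[OF sub] by blast
  then have pos: "card (point_stabilizer P \<omega>) > 0" using ord finP card_gt_0_iff by force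
  have bound: "card F \<le> card (point_stabilizer P \<omega>)" if F: "F \<subseteq> P" "intersecting \<Omega> F" for F
  proof -
    have "inj_on (\<lambda>(g, i). compose \<Omega> g (n i)) (F \<times> I)"
    proof (rule inj_onI, clarify)
      fix g i h j assume gh: "g \<in> F" "h \<in> F" and ij: "i \<in> I" "j \<in> I"
        and eq: "compose \<Omega> g (n i) = compose \<Omega> h (n j)"
      obtain y where y: "y \<in> \<Omega>" "g y = h y" using F(2) gh by (auto simp: intersecting_def)
      then obtain x where x: "x \<in> \<Omega>" "n i x = y"
        using surj[OF n[OF ij(1)]] by blast
      have "g (n i x) = h (n j x)" using fun_cong[OF eq, of x] x by (simp add: compose_eq)
      then have "h (n i x) = h (n j x)" using x y by simp
      then have "n i x = n j x"
        using bij_betw_imp_inj_on[OF bij(1)[of h]] gh F(1) closed[OF n[OF ij(1)] x(1)]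
          closed[OF n[OF ij(2)] x(1)] by (auto dest: inj_onD)
      then have ij_eq: "i = j" using clique[OF ij x(1)] by simp
      have "g z = h z" if z: "z \<in> \<Omega>" for z
      proof -
        obtain w where w: "w \<in> \<Omega>" "n i w = z"
          using surj[OF n[OF ij(1)] z] by blast
        then show ?thesis using fun_cong[OF eq, of w] ij_eq by (simp add: compose_eq)
      qed
      then have "g = h" using bij(2) gh F(1) by (intro extensionalityI[of _ \<Omega>]) auto
      then show "g = h \<and> i = j" using ij_eq by simp
    qed
    moreover have "(\<lambda>(g, i). compose \<Omega> g (n i)) ` (F \<times> I) \<subseteq> P"
      using F(1) n mult subgroup.m_closed[OF sub] by fastforce
    ultimately have "card (F \<times> I) \<le> card P" using finP by (rule card_inj_on_le)
    then have "card F * card \<Omega> \<le> card (point_stabilizer P \<omega>) * card \<Omega>"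
      using ord I by (simp add: card_cartesian_product mult.commute)
    then show ?thesis using card0 by simp
  qed
  let ?R = "{real (card F) / real (card (point_stabilizer P \<omega>)) | F. F \<subseteq> P \<and> intersecting \<Omega> F}"
  have "Max ?R = 1"
  proof (rule Max_eqI)
    have R: "?R = (\<lambda>F. real (card F) / real (card (point_stabilizer P \<omega>))) ` {F. F \<subseteq> P \<and> intersecting \<Omega> F}"
      by auto
    have "finite {F. F \<subseteq> P \<and> intersecting \<Omega> F}"
      using finP by (auto intro: rev_finite_subset[of "Pow P"])
    then show "finite ?R" unfolding R by (rule finite_imageI)
    show "y \<le> 1" if "y \<in> ?R" for y using that bound pos by auto
    have "point_stabilizer P \<omega> \<subseteq> P" by (auto simp: point_stabilizer_def)
    moreover have "intersecting \<Omega> (point_stabilizer P \<omega>)"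
      using \<omega> by (auto simp: intersecting_def point_stabilizer_def intro!: bexI[of _ \<omega>])
    ultimately show "1 \<in> ?R" using pos by (intro CollectI exI[of _ "point_stabilizer P \<omega>"]) auto
  qed
  then show ?thesis by (simp add: intersection_density_def)
qed

lemma minus_one_dvd_power_minus_one: "(m - 1) dvd (m ^ k - 1 :: nat)"
proof (induction k)
  case (Suc k)
  show ?case
  proof (cases "m = 0")
    case False
    then have "m ^ Suc k - 1 = (m - 1) * m ^ k + (m ^ k - 1)"
      by (simp add: diff_mult_distrib)
    then show ?thesis using Suc by simp
  qed simp
qed simp

theorem theorem1p2:
  fixes q p :: nat
    and \<Omega> :: "'a set" and \<omega> :: 'a
    and \<phi> :: "'k::{field,finite} mat set \<Rightarrow> 'a \<Rightarrow> 'a"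
  assumes "prime q" and "odd q"
    and "card (UNIV :: 'k set) = q"
    and "p = (q ^ q - 1) div (q - 1)" and "prime p"
    and "group_action (PSL q) \<Omega> \<phi>"
    and "imprimitive_perm_group \<Omega> (\<phi> ` carrier (PSL q))"
    and "card \<Omega> = p * q"
    and "\<omega> \<in> \<Omega>"
  shows "intersection_density \<Omega> (\<phi> ` carrier (PSL q)) \<omega> = 1"
proof -
  interpret F: odd_prime_field q "TYPE('k)" by unfold_locales (use assms in auto)
  interpret ga: group_action "PSL q :: 'k mat set monoid" \<Omega> \<phi> by (rule assms)
  interpret B: group "BijGroup \<Omega>" by (rule group_BijGroup)
  let ?P = "\<phi> ` carrier (PSL q)"
  \<comment> \<open>The action lifted from \<open>PSL\<^sub>q(q)\<close> to \<open>SL\<^sub>q(q)\<close>.\<close>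
  define \<psi> where "\<psi> A = \<phi> (scalars_SL q #>\<^bsub>SL q\<^esub> A)" for A :: "'k mat"
  have coset: "(\<lambda>A. scalars_SL q #>\<^bsub>SL q\<^esub> A) \<in> hom (SL q) (PSL q :: 'k mat set monoid)"
    unfolding PSL_def by (rule normal.r_coset_hom_Mod[OF normal_scalars_SL])
  have hom: "\<psi> \<in> hom (SL q) (BijGroup \<Omega>)"
    using hom_compose[OF coset group_hom.homh[OF ga.group_hom]]
    by (simp add: \<psi>_def[abs_def] comp_def)
  have P: "?P = \<psi> ` carrier (SL q)"
    by (auto simp: PSL_def FactGroup_def RCOSETS_def \<psi>_def)
  have Bij: "\<psi> A \<in> Bij \<Omega>" if "A \<in> carrier (SL q)" for A
    using hom_in_carrier[OF hom that] by (simp add: BijGroup_def)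
  interpret act: set_action "SL q :: 'k mat monoid" \<Omega> \<psi>
  proof unfold_locales
    show "\<psi> A x \<in> \<Omega>" if "A \<in> carrier (SL q)" "x \<in> \<Omega>" for A x
      using Bij[OF that(1)] that(2) by (auto simp: Bij_def bij_betw_def)
    have "\<psi> \<one>\<^bsub>SL q\<^esub> = \<one>\<^bsub>BijGroup \<Omega>\<^esub>"
      using hom_one[OF hom group_SL group_BijGroup] .
    then show "\<psi> \<one>\<^bsub>SL q\<^esub> x = x" if "x \<in> \<Omega>" for x using that by (simp add: BijGroup_def)
    show "\<psi> (A \<otimes>\<^bsub>SL q\<^esub> C) x = \<psi> A (\<psi> C x)"
      if "A \<in> carrier (SL q)" "C \<in> carrier (SL q)" "x \<in> \<Omega>" for A C x
      using hom_mult[OF hom that(1,2)] Bij[OF that(1)] Bij[OF that(2)] that(3)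
      by (simp add: BijGroup_def compose_eq)
  qed
  have tp: "transitive_perm_group \<Omega> ?P"
    using assms(7) by (simp add: imprimitive_perm_group_def)
  obtain S where S: "S \<subseteq> \<Omega>" "1 < card S" "card S < card \<Omega>"
    "\<forall>g\<in>?P. g ` S = S \<or> g ` S \<inter> S = {}"
    using assms(7) by (auto simp: imprimitive_perm_group_def)
  have "(q - 1) dvd (q ^ q - 1)" by (rule minus_one_dvd_power_minus_one)
  then have p_eq: "p * (q - 1) = q ^ q - 1" unfolding assms(4) by simp
  interpret M: sl_imprimitive q "TYPE('k)" \<Omega> \<psi> p S
  proof unfold_locales
    show "\<exists>g\<in>carrier (SL q). \<psi> g x = y" if "x \<in> \<Omega>" "y \<in> \<Omega>" for x y
      using tp that unfolding transitive_perm_group_def P by blast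
    show "\<psi> g ` S = S \<or> \<psi> g ` S \<inter> S = {}" if "g \<in> carrier (SL q)" for g
      using S(4) that unfolding P by blast
  qed (use assms p_eq S in auto)
  let ?n = "\<lambda>(i :: nat, j :: nat).
    \<psi> (F.artin_schreier [^]\<^bsub>SL q\<^esub> i \<otimes>\<^bsub>SL q\<^esub> F.pascal [^]\<^bsub>SL q\<^esub> j)"
  show ?thesis
  proof (rule intersection_density_eq_1_if_clique[OF tp M.finite_Omega assms(9), of "{..<p} \<times> {..<q}" ?n])
    show "card ({..<p} \<times> {..<q}) = card \<Omega>" using assms(8) by (simp add: card_cartesian_product)
    show "?n i \<in> ?P" if "i \<in> {..<p} \<times> {..<q}" for i
      unfolding P using F.artin_schreier_SL F.pascal_SL by (auto split: prod.split)
    fix i j x assume ij: "i \<in> {..<p} \<times> {..<q}" "j \<in> {..<p} \<times> {..<q}" and x: "x \<in> \<Omega>"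
      and eq: "?n i x = ?n j x"
    have "fst i = fst j \<and> snd i = snd j"
    proof (rule act.frobenius_group_semiregular[OF F.artin_schreier_SL F.pascal_SL _ _ F.pascal_pow_q
          assms(5,1) M.p_gt M.artin_schreier_fixed_point_free M.pascal_fixed_point_free _ _ _ _ x])
      show "F.pascal \<otimes>\<^bsub>SL q\<^esub> F.artin_schreier = F.artin_schreier [^]\<^bsub>SL q\<^esub> q \<otimes>\<^bsub>SL q\<^esub> F.pascal"
        using F.pascal_artin_schreier by (simp add: mult_SL)
      show "F.artin_schreier [^]\<^bsub>SL q\<^esub> p = \<one>\<^bsub>SL q\<^esub>" by (rule F.artin_schreier_pow_p[OF p_eq])
    qed (use ij eq in \<open>auto simp: case_prod_beta\<close>)
    then show "i = j" by (simp add: prod_eq_iff)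
  qed
qed

end
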